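(* Let $k$ be a field and let $A$ be a short local $k$-algebra of Hilbert type $(e,a)$. If $a\le\frac14e^2$, then $\gamma_A\ge\frac12\bigl(e+\sqrt{e^2-4a}\bigr)$.
   Context: A short local $k$-algebra is a finite-dimensional local $k$-algebra $A$ whose radical $J$ satisfies $J^3=0$; we assume $A/J=k$ and write $S=A/J$ for the simple module. Its Hilbert type is $(e,a)$ with $e=|J/J^2|$, $a=|J^2|$ (lengths). Modules are left modules of finite length. $\Omega M$ is the kernel of a projective cover of $M$, $\Omega^0M=M$, $\Omega^{n+1}M=\Omega(\Omega^nM)$; $t_n(M)$ is the length of $\Omega^nM/J\Omega^nM$; $\gamma(M)=\limsup_n\sqrt[n]{t_n(M)}$ and $\gamma_A=\gamma(S)$. *)

theory Defs
  imports "HOL-Algebra.Algebra" "HOL-Library.Extended_Real"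
begin

section \<open>Left modules over a not necessarily commutative ring\<close>

text \<open>The library locale \<^locale>\<open>module\<close> requires a commutative ring of scalars. The following locale
  has the same axioms over an arbitrary ring. The record is the library's; its fields \<^const>\<open>mult\<close>
  and \<^const>\<open>one\<close> play no role for a module.\<close>

locale left_module = R?: ring R + M?: abelian_group M
  for R :: "('a, 'r) ring_scheme" and M :: "('a, 'm, 'z) module_scheme" (structure) +
  assumes smult_closed [simp, intro]:
      "\<lbrakk>a \<in> carrier R; x \<in> carrier M\<rbrakk> \<Longrightarrow> a \<odot>\<^bsub>M\<^esub> x \<in> carrier M"
    and smult_l_distr:
      "\<lbrakk>a \<in> carrier R; b \<in> carrier R; x \<in> carrier M\<rbrakk> \<Longrightarrow>
      (a \<oplus>\<^bsub>R\<^esub> b) \<odot>\<^bsub>M\<^esub> x = a \<odot>\<^bsub>M\<^esub> x \<oplus>\<^bsub>M\<^esub> b \<odot>\<^bsub>M\<^esub> x"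
    and smult_r_distr:
      "\<lbrakk>a \<in> carrier R; x \<in> carrier M; y \<in> carrier M\<rbrakk> \<Longrightarrow>
      a \<odot>\<^bsub>M\<^esub> (x \<oplus>\<^bsub>M\<^esub> y) = a \<odot>\<^bsub>M\<^esub> x \<oplus>\<^bsub>M\<^esub> a \<odot>\<^bsub>M\<^esub> y"
    and smult_assoc1:
      "\<lbrakk>a \<in> carrier R; b \<in> carrier R; x \<in> carrier M\<rbrakk> \<Longrightarrow>
      (a \<otimes>\<^bsub>R\<^esub> b) \<odot>\<^bsub>M\<^esub> x = a \<odot>\<^bsub>M\<^esub> (b \<odot>\<^bsub>M\<^esub> x)"
    and smult_one [simp]:
      "x \<in> carrier M \<Longrightarrow> \<one>\<^bsub>R\<^esub> \<odot>\<^bsub>M\<^esub> x = x"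

definition regular_module :: "('a, 'z) ring_scheme \<Rightarrow> ('a, 'a) module" where
  "regular_module R = \<lparr>carrier = carrier R, monoid.mult = (\<otimes>\<^bsub>R\<^esub>), one = \<one>\<^bsub>R\<^esub>,
     ring.zero = \<zero>\<^bsub>R\<^esub>, ring.add = (\<oplus>\<^bsub>R\<^esub>), smult = (\<otimes>\<^bsub>R\<^esub>)\<rparr>"

definition module_hom ::
    "('a, 'z) ring_scheme \<Rightarrow> ('a, 'm) module \<Rightarrow> ('a, 'n) module \<Rightarrow> ('m \<Rightarrow> 'n) set" where
  "module_hom R M N = {f \<in> carrier M \<rightarrow> carrier N.
     (\<forall>x\<in>carrier M. \<forall>y\<in>carrier M. f (x \<oplus>\<^bsub>M\<^esub> y) = f x \<oplus>\<^bsub>N\<^esub> f y) \<and>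
     (\<forall>a\<in>carrier R. \<forall>x\<in>carrier M. f (a \<odot>\<^bsub>M\<^esub> x) = a \<odot>\<^bsub>N\<^esub> f x)}"

definition module_quot :: "('a, 'm) module \<Rightarrow> 'm set \<Rightarrow> ('a, 'm set) module" where
  "module_quot M N = \<lparr>carrier = a_rcosets\<^bsub>M\<^esub> N, monoid.mult = rcoset_mult M N, one = N +>\<^bsub>M\<^esub> \<one>\<^bsub>M\<^esub>,
     ring.zero = N, ring.add = set_add M, smult = (\<lambda>a C. \<Union>x\<in>C. N +>\<^bsub>M\<^esub> (a \<odot>\<^bsub>M\<^esub> x))\<rparr>"

definition submodule_chain :: "('a, 'z) ring_scheme \<Rightarrow> ('a, 'm) module \<Rightarrow> nat \<Rightarrow> (nat \<Rightarrow> 'm set) \<Rightarrow> bool"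
  where "submodule_chain R M n C \<longleftrightarrow>
    (\<forall>i\<le>n. submodule (C i) R M) \<and> (\<forall>i<n. C i \<subset> C (Suc i))"

definition module_length :: "('a, 'z) ring_scheme \<Rightarrow> ('a, 'm) module \<Rightarrow> enat" where
  "module_length R M = Sup {enat n | n. \<exists>C. submodule_chain R M n C}"

definition fin_length_module :: "('a, 'z) ring_scheme \<Rightarrow> ('a, 'm) module \<Rightarrow> bool" where
  "fin_length_module R M \<longleftrightarrow> left_module R M \<and> module_length R M < \<infinity>"


section \<open>The radical\<close>

definition maximal_left_ideal :: "('a, 'z) ring_scheme \<Rightarrow> 'a set \<Rightarrow> bool" where
  "maximal_left_ideal R I \<longleftrightarrow> submodule I R (regular_module R) \<and> I \<noteq> carrier R \<and>
     (\<forall>I'. submodule I' R (regular_module R) \<and> I \<subseteq> I' \<longrightarrow> I' = I \<or> I' = carrier R)"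

definition radical :: "('a, 'z) ring_scheme \<Rightarrow> 'a set" where
  "radical R = carrier R \<inter> \<Inter> {I. maximal_left_ideal R I}"

definition is_local_ring :: "('a, 'z) ring_scheme \<Rightarrow> bool" where
  "is_local_ring R \<longleftrightarrow> ring R \<and> (\<exists>!I. maximal_left_ideal R I)"

text \<open>The submodule \<open>JM\<close>, where \<open>J\<close> is the radical of \<open>R\<close>.\<close>

definition rad_mult :: "('a, 'z) ring_scheme \<Rightarrow> ('a, 'm) module \<Rightarrow> 'm set" where
  "rad_mult R M =
     generate (add_monoid M) {j \<odot>\<^bsub>M\<^esub> x | j x. j \<in> radical R \<and> x \<in> carrier M}"

definition top_length :: "('a, 'z) ring_scheme \<Rightarrow> ('a, 'm) module \<Rightarrow> nat" where
  "top_length R M = the_enat (module_length R (module_quot M (rad_mult R M)))"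

definition simple_top :: "('a, 'z) ring_scheme \<Rightarrow> ('a, 'a set) module" where
  "simple_top R = module_quot (regular_module R) (radical R)"


section \<open>Projective covers and syzygies\<close>

text \<open>A quantifier cannot range over modules on carriers of all types. Modules on subsets of
  \<^typ>\<open>nat \<Rightarrow> 'a\<close> are used instead: every module of finite length over a ring with elements in \<^typ>\<open>'a\<close>
  is a quotient of a finite free module, hence isomorphic to a module of this kind, so that these
  modules form a category equivalent to that of all modules of finite length.\<close>

type_synonym 'a umodule = "('a, nat \<Rightarrow> 'a) module"

definition projective :: "('a, 'z) ring_scheme \<Rightarrow> 'a umodule \<Rightarrow> bool" where
  "projective R P \<longleftrightarrow> fin_length_module R P \<and>
     (\<forall>(M :: 'a umodule) (N :: 'a umodule) g h.
        fin_length_module R M \<and> fin_length_module R N \<and>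
        g \<in> module_hom R M N \<and> g ` carrier M = carrier N \<and> h \<in> module_hom R P N \<longrightarrow>
        (\<exists>h' \<in> module_hom R P M. \<forall>p\<in>carrier P. g (h' p) = h p))"

text \<open>A projective cover is an epimorphism from a projective module with superfluous kernel.\<close>

definition projective_cover ::
    "('a, 'z) ring_scheme \<Rightarrow> 'a umodule \<Rightarrow> ('a, 'm) module \<Rightarrow> ((nat \<Rightarrow> 'a) \<Rightarrow> 'm) \<Rightarrow> bool" where
  "projective_cover R P M f \<longleftrightarrow> projective R P \<and>
     f \<in> module_hom R P M \<and> f ` carrier P = carrier M \<and>
     (\<forall>U. submodule U R P \<and> set_add P U (a_kernel P M f) = carrier P \<longrightarrow> U = carrier P)"

text \<open>The syzygy module is determined up to isomorphism only; one is chosen.\<close>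

definition Omega :: "('a, 'z) ring_scheme \<Rightarrow> ('a, 'm) module \<Rightarrow> 'a umodule" where
  "Omega R M = (SOME N. \<exists>P f. projective_cover R P M f \<and> N = P\<lparr>carrier := a_kernel P M f\<rparr>)"

text \<open>The first step is separated because the elements of \<open>M\<close> may be of any type.\<close>

definition betti :: "('a, 'z) ring_scheme \<Rightarrow> nat \<Rightarrow> ('a, 'm) module \<Rightarrow> nat" where
  "betti R n M = (case n of 0 \<Rightarrow> top_length R M
     | Suc m \<Rightarrow> top_length R ((Omega R ^^ m) (Omega R M)))"

definition growth :: "('a, 'z) ring_scheme \<Rightarrow> ('a, 'm) module \<Rightarrow> ereal" where
  "growth R M = limsup (\<lambda>n. ereal (root n (real (betti R n M))))"


section \<open>Short local algebras\<close>

text \<open>The library locale \<^locale>\<open>algebra\<close> is restricted to commutative algebras.\<close>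

locale k_algebra = module K A + K?: field K + A?: ring A
  for K and A (structure) +
  assumes smult_mult_left:
      "\<lbrakk>c \<in> carrier K; x \<in> carrier A; y \<in> carrier A\<rbrakk> \<Longrightarrow>
      (c \<odot>\<^bsub>A\<^esub> x) \<otimes>\<^bsub>A\<^esub> y = c \<odot>\<^bsub>A\<^esub> (x \<otimes>\<^bsub>A\<^esub> y)"
    and smult_mult_right:
      "\<lbrakk>c \<in> carrier K; x \<in> carrier A; y \<in> carrier A\<rbrakk> \<Longrightarrow>
      x \<otimes>\<^bsub>A\<^esub> (c \<odot>\<^bsub>A\<^esub> y) = c \<odot>\<^bsub>A\<^esub> (x \<otimes>\<^bsub>A\<^esub> y)"

definition fin_dim :: "('k, 'y) ring_scheme \<Rightarrow> ('k, 'a) module \<Rightarrow> bool" where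
  "fin_dim K V \<longleftrightarrow> (\<exists>B. finite B \<and> B \<subseteq> carrier V \<and>
     (\<forall>x\<in>carrier V. \<exists>c \<in> B \<rightarrow> carrier K. x = (\<Oplus>\<^bsub>V\<^esub>b\<in>B. c b \<odot>\<^bsub>V\<^esub> b)))"

text \<open>The condition \<open>A/J = k\<close> says that the structure map from \<open>k\<close> to \<open>A/J\<close> is an isomorphism.\<close>

definition short_local_algebra :: "('k, 'y) ring_scheme \<Rightarrow> ('k, 'a) module \<Rightarrow> bool" where
  "short_local_algebra K A \<longleftrightarrow> k_algebra K A \<and> fin_dim K A \<and> is_local_ring A \<and>
     radical A \<cdot>\<^bsub>A\<^esub> radical A \<cdot>\<^bsub>A\<^esub> radical A = {\<zero>\<^bsub>A\<^esub>} \<and>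
     (\<lambda>c. radical A +>\<^bsub>A\<^esub> (c \<odot>\<^bsub>A\<^esub> \<one>\<^bsub>A\<^esub>)) \<in> ring_iso K (A Quot radical A)"

definition hilbert_type :: "('a, 'z) ring_scheme \<Rightarrow> nat \<Rightarrow> nat \<Rightarrow> bool" where
  "hilbert_type R e a \<longleftrightarrow>
     (let J = radical R; J2 = J \<cdot>\<^bsub>R\<^esub> J; M = regular_module R
      in module_length R (module_quot (M\<lparr>carrier := J\<rparr>) J2) = enat e \<and>
         module_length R (M\<lparr>carrier := J2\<rparr>) = enat a)"

definition gamma_alg :: "('a, 'z) ring_scheme \<Rightarrow> ereal" where
  "gamma_alg R = growth R (simple_top R)"

end

(*
  A projective cover of M over a short local ring is a free module F of rank t = t(M), and the syzygy
  N lies in JF. Hence |N| + |M| = t (1 + e + a), while JN lies in J^2 F and so has length at most t a.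
  With |M| = t + |JM| and |N| = t(N) + |JN| this yields t(N) >= e t(M) - |JM|, and therefore the Betti
  numbers b_n of the simple module satisfy b_(n+2) >= e b_(n+1) - a b_n, with b_0 = 1 and b_1 >= e.
  If r >= s >= 0 are the roots of x^2 - e x + a, which are real for 4a <= e^2, then b_(n+1) - s b_n
  grows at least by the factor r in each step, so b_n >= r^n.
*)

theory Submission
  imports Defs
begin

section \<open>Chains and length\<close>

text \<open>That it is free, and that the syzygy lies in JF, has to be extracted from this.
  Nakayama's lemma then makes the splitting of a minimal free cover of a projective module
  bijective. The existence of a cover has to be shown as well, for otherwise the choice is
  unconstrained.

  Length is a supremum over chains, so its additivity is proved on chains, infinite values included.

  The estimate for the Betti numbers is an inequality in which b_n has the coefficient -a. A lower
  bound on b_n therefore cannot be inserted into it; subtracting s times the preceding term replaces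
  it by a first-order inequality with the nonnegative factor r.\<close>

definition has_chain :: "'x set set \<Rightarrow> nat \<Rightarrow> bool" where
  "has_chain F n \<longleftrightarrow> (\<exists>C. (\<forall>i\<le>n. C i \<in> F) \<and> (\<forall>i<n. C i \<subset> C (Suc i)))"

text \<open>Heights are taken of arbitrary families of sets, so that the submodules of M, those
  inside a submodule K and those containing K are compared on one carrier, without forming
  M/K.\<close>

definition height :: "'x set set \<Rightarrow> enat" where
  "height F = Sup {enat n | n. has_chain F n}"

lemma has_chain_0_iff [simp]: "has_chain F 0 \<longleftrightarrow> F \<noteq> {}"
  unfolding has_chain_def by auto

lemma has_chain_antimono: "has_chain F n \<Longrightarrow> m \<le> n \<Longrightarrow> has_chain F m"
  unfolding has_chain_def by (metis le_trans less_le_trans)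

lemma has_chain_imp_le_height: "has_chain F n \<Longrightarrow> enat n \<le> height F"
  unfolding height_def by (rule Sup_upper) auto

text \<open>A supremum of naturals that is at least \<open>Suc k\<close> exceeds \<open>k\<close>,
  so some chain has more than \<open>k\<close> steps and can be truncated. Nonemptiness matters at
  0: the empty family has height 0 but no chain.\<close>

lemma le_height_iff:
  assumes "F \<noteq> {}"
  shows "enat n \<le> height F \<longleftrightarrow> has_chain F n"
proof
  assume n: "enat n \<le> height F"
  show "has_chain F n"
  proof (cases n)
    case 0
    with assms show ?thesis by simp
  next
    case (Suc k)
    with n have "enat k < height F"
      by (metis Suc_ile_eq)
    then obtain m where "has_chain F m" "k < m"
      unfolding height_def less_Sup_iff by auto
    with Suc show ?thesis by (auto intro: has_chain_antimono)
  qed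
qed (rule has_chain_imp_le_height)

text \<open>Reduces a bound on a sum to finite lower bounds of the summands. If one summand is
  infinite, pairing its lower bounds with 0 puts every natural number below
  \<open>z\<close>.\<close>

lemma enat_add_leI:
  assumes "\<And>n m. enat n \<le> x \<Longrightarrow> enat m \<le> y \<Longrightarrow> enat (n + m) \<le> z"
  shows "x + y \<le> z"
proof (cases "x = \<infinity> \<or> y = \<infinity>")
  case True
  have "enat n \<le> z" for n
    using True assms[of n 0] assms[of 0 n] by (auto simp: zero_enat_def[symmetric])
  from this[of "Suc (the_enat z)"] have "z = \<infinity>"
    by (cases z) auto
  then show ?thesis by simp
next
  case False
  then obtain n m where "x = enat n" "y = enat m" by auto
  with assms[of n m] show ?thesis by simp
qed

lemma height_le_height:
  assumes "\<And>S. S \<in> F \<Longrightarrow> p S \<in> G"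
    and "\<And>S T. S \<in> F \<Longrightarrow> T \<in> F \<Longrightarrow> S \<subset> T \<Longrightarrow> p S \<subset> p T"
  shows "height F \<le> height G"
  unfolding height_def
proof (rule Sup_mono, clarsimp)
  fix n assume "has_chain F n"
  then obtain C where "\<forall>i\<le>n. C i \<in> F" "\<forall>i<n. C i \<subset> C (Suc i)"
    unfolding has_chain_def by auto
  then have "has_chain G n"
    unfolding has_chain_def using assms
    by (intro exI[of _ "\<lambda>i. p (C i)"]) (auto simp: Suc_leI less_imp_le)
  then show "\<exists>m. (\<exists>k. m = enat k \<and> has_chain G k) \<and> enat n \<le> m"
    by auto
qed

lemma height_add_le:
  assumes "G \<subseteq> F" "H \<subseteq> F" "G \<noteq> {}" "H \<noteq> {}"
    and below: "\<And>S T. S \<in> G \<Longrightarrow> T \<in> H \<Longrightarrow> S \<subseteq> T"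
  shows "height G + height H \<le> height F"
proof (rule enat_add_leI)
  fix n m assume "enat n \<le> height G" "enat m \<le> height H"
  then have "has_chain G n" "has_chain H m"
    using assms by (simp_all add: le_height_iff)
  then obtain C D where C: "\<And>i. i \<le> n \<Longrightarrow> C i \<in> G" "\<And>i. i < n \<Longrightarrow> C i \<subset> C (Suc i)"
    and D: "\<And>i. i \<le> m \<Longrightarrow> D i \<in> H" "\<And>i. i < m \<Longrightarrow> D i \<subset> D (Suc i)"
    unfolding has_chain_def by metis
  \<comment> \<open>The chains may meet with \<open>C n = D 0\<close>, so \<open>D 0\<close> is left
    out: \<open>C n\<close> is followed by \<open>D 1\<close>, and the joint is strict because
    \<open>D 0\<close> is properly contained in \<open>D 1\<close>.\<close>
  define E where "E = (\<lambda>i. if i \<le> n then C i else D (i - n))"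
  have "E i \<in> F" if "i \<le> n + m" for i
  proof (cases "i \<le> n")
    case False
    then have "i - n \<le> m" using that by simp
    with False show ?thesis using D(1) assms(2) by (auto simp: E_def)
  qed (use C(1) assms(1) in \<open>auto simp: E_def\<close>)
  moreover have "E i \<subset> E (Suc i)" if "i < n + m" for i
  proof -
    consider "i < n" | "i = n" | "i > n" by linarith
    then show ?thesis
    proof cases
      case 1
      then show ?thesis using C(2)[of i] by (simp add: E_def)
    next
      case 2
      then have "C n \<subseteq> D 0" "D 0 \<subset> D (Suc 0)"
        using that C(1)[of n] D(1)[of 0] D(2)[of 0] below by auto
      with 2 show ?thesis by (auto simp: E_def)
    next
      case 3
      then have "Suc i - n = Suc (i - n)" "i - n < m" using that by auto
      with 3 show ?thesis using D(2)[of "i - n"] by (auto simp: E_def)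
    qed
  qed
  ultimately have "has_chain F (n + m)"
    unfolding has_chain_def by blast
  then show "enat (n + m) \<le> height F"
    by (rule has_chain_imp_le_height)
qed

text \<open>Deleting repetitions from a weakly increasing sequence leaves one strict step for each
  index at which it moves.\<close>

lemma has_chain_of_mono:
  assumes "\<And>i. i \<le> n \<Longrightarrow> C i \<in> F" "\<And>i. i < n \<Longrightarrow> C i \<subseteq> C (Suc i)"
  shows "has_chain F (card {i. i < n \<and> C i \<noteq> C (Suc i)})"
proof -
  \<comment> \<open>Recording the last member \<open>D k = C n\<close> tells the induction where to
    append the next set.\<close>
  have "\<exists>D. (\<forall>i\<le>k. D i \<in> F) \<and> (\<forall>i<k. D i \<subset> D (Suc i)) \<and> D k = C n"
    if "k = card {i. i < n \<and> C i \<noteq> C (Suc i)}" for k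
    using assms that
  proof (induction n arbitrary: k)
    case 0
    then show ?case by (auto intro: exI[of _ C])
  next
    case (Suc n)
    define c where "c = card {i. i < n \<and> C i \<noteq> C (Suc i)}"
    obtain D where D: "\<forall>i\<le>c. D i \<in> F" "\<forall>i<c. D i \<subset> D (Suc i)" "D c = C n"
      using Suc.IH[OF Suc.prems(1,2) c_def] by auto
    show ?case
    proof (cases "C n = C (Suc n)")
      case True
      then have "{i. i < Suc n \<and> C i \<noteq> C (Suc i)} = {i. i < n \<and> C i \<noteq> C (Suc i)}"
        by (auto simp: less_Suc_eq)
      then have "k = c" using Suc.prems(3) c_def by simp
      with D True show ?thesis by auto
    next
      case False
      then have "{i. i < Suc n \<and> C i \<noteq> C (Suc i)} = insert n {i. i < n \<and> C i \<noteq> C (Suc i)}"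
        by (auto simp: less_Suc_eq)
      then have k: "k = Suc c" using Suc.prems(3) c_def by simp
      have "C n \<subset> C (Suc n)" using False Suc.prems(2)[of n] by auto
      with D k show ?thesis
        using Suc.prems(1)[of "Suc n"]
        by (intro exI[of _ "D(Suc c := C (Suc n))"]) (auto simp: less_Suc_eq le_Suc_eq)
    qed
  qed
  from this[OF refl] show ?thesis unfolding has_chain_def by auto
qed

text \<open>At a strict step of a chain in \<open>F\<close>, \<open>inj\<close> prevents both images
  from standing still. So every step is counted among the moves of the \<open>p\<close>-image or
  among those of the \<open>q\<close>-image, and each of these counts is the length of a strict
  chain.\<close>

lemma height_le_add:
  assumes p: "\<And>S. S \<in> F \<Longrightarrow> p S \<in> G" and q: "\<And>S. S \<in> F \<Longrightarrow> q S \<in> H"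
    and mono: "\<And>S T. S \<in> F \<Longrightarrow> T \<in> F \<Longrightarrow> S \<subseteq> T \<Longrightarrow> p S \<subseteq> p T"
      "\<And>S T. S \<in> F \<Longrightarrow> T \<in> F \<Longrightarrow> S \<subseteq> T \<Longrightarrow> q S \<subseteq> q T"
    and inj: "\<And>S T. S \<in> F \<Longrightarrow> T \<in> F \<Longrightarrow> S \<subseteq> T \<Longrightarrow> p S = p T \<Longrightarrow> q S = q T \<Longrightarrow> S = T"
  shows "height F \<le> height G + height H"
proof -
  have "enat n \<le> height G + height H" if "has_chain F n" for n
  proof -
    from that obtain C where C: "\<And>i. i \<le> n \<Longrightarrow> C i \<in> F" "\<And>i. i < n \<Longrightarrow> C i \<subset> C (Suc i)"
      unfolding has_chain_def by metis
    let ?A = "{i. i < n \<and> p (C i) \<noteq> p (C (Suc i))}"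
    let ?B = "{i. i < n \<and> q (C i) \<noteq> q (C (Suc i))}"
    have G: "has_chain G (card ?A)"
      by (rule has_chain_of_mono) (use p C mono in \<open>auto simp: Suc_leI less_imp_le\<close>)
    have H: "has_chain H (card ?B)"
      by (rule has_chain_of_mono) (use q C mono in \<open>auto simp: Suc_leI less_imp_le\<close>)
    have "{..<n} \<subseteq> ?A \<union> ?B"
    proof
      fix i assume "i \<in> {..<n}"
      then have "C i \<in> F" "C (Suc i) \<in> F" "C i \<subset> C (Suc i)" "i < n"
        using C by (auto simp: Suc_leI less_imp_le)
      then show "i \<in> ?A \<union> ?B" using inj by blast
    qed
    then have "card {..<n} \<le> card (?A \<union> ?B)"
      by (intro card_mono) auto
    then have "n \<le> card (?A \<union> ?B)" by simp
    also have "\<dots> \<le> card ?A + card ?B" by (rule card_Un_le)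
    finally have "enat n \<le> enat (card ?A) + enat (card ?B)" by simp
    also have "\<dots> \<le> height G + height H"
      using G H by (intro add_mono has_chain_imp_le_height)
    finally show ?thesis .
  qed
  then show ?thesis
    unfolding height_def[of F] by (intro Sup_least) blast
qed

lemma module_length_eq_height: "module_length R M = height {C. submodule C R M}"
  unfolding module_length_def height_def has_chain_def submodule_chain_def by simp


section \<open>Left modules\<close>

context left_module
begin

lemma smult_l_null [simp]:
  assumes "x \<in> carrier M" shows "\<zero>\<^bsub>R\<^esub> \<odot>\<^bsub>M\<^esub> x = \<zero>\<^bsub>M\<^esub>"
proof -
  have "\<zero>\<^bsub>R\<^esub> \<odot>\<^bsub>M\<^esub> x \<oplus>\<^bsub>M\<^esub> \<zero>\<^bsub>R\<^esub> \<odot>\<^bsub>M\<^esub> x = \<zero>\<^bsub>R\<^esub> \<odot>\<^bsub>M\<^esub> x"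
    using assms smult_l_distr[of "\<zero>\<^bsub>R\<^esub>" "\<zero>\<^bsub>R\<^esub>" x] by simp
  then show ?thesis using assms by (metis M.add.r_cancel_one R.zero_closed smult_closed)
qed

lemma smult_r_null [simp]:
  assumes "r \<in> carrier R" shows "r \<odot>\<^bsub>M\<^esub> \<zero>\<^bsub>M\<^esub> = \<zero>\<^bsub>M\<^esub>"
proof -
  have "r \<odot>\<^bsub>M\<^esub> \<zero>\<^bsub>M\<^esub> \<oplus>\<^bsub>M\<^esub> r \<odot>\<^bsub>M\<^esub> \<zero>\<^bsub>M\<^esub> = r \<odot>\<^bsub>M\<^esub> \<zero>\<^bsub>M\<^esub>"
    using assms smult_r_distr[of r "\<zero>\<^bsub>M\<^esub>" "\<zero>\<^bsub>M\<^esub>"] by simp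
  then show ?thesis using assms by (metis M.add.r_cancel_one M.zero_closed smult_closed)
qed

lemma smult_r_minus:
  assumes "r \<in> carrier R" "x \<in> carrier M"
  shows "r \<odot>\<^bsub>M\<^esub> (\<ominus>\<^bsub>M\<^esub> x) = \<ominus>\<^bsub>M\<^esub> (r \<odot>\<^bsub>M\<^esub> x)"
proof -
  have "r \<odot>\<^bsub>M\<^esub> (\<ominus>\<^bsub>M\<^esub> x) \<oplus>\<^bsub>M\<^esub> r \<odot>\<^bsub>M\<^esub> x = \<zero>\<^bsub>M\<^esub>"
    using assms smult_r_distr[of r "\<ominus>\<^bsub>M\<^esub> x" x] by (simp add: M.l_neg)
  then show ?thesis using assms by (metis M.add.inv_closed M.minus_equality smult_closed)
qed

lemma minus_eq_smult:
  assumes "x \<in> carrier M"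
  shows "\<ominus>\<^bsub>M\<^esub> x = (\<ominus>\<^bsub>R\<^esub> \<one>\<^bsub>R\<^esub>) \<odot>\<^bsub>M\<^esub> x"
proof -
  have "(\<ominus>\<^bsub>R\<^esub> \<one>\<^bsub>R\<^esub>) \<odot>\<^bsub>M\<^esub> x \<oplus>\<^bsub>M\<^esub> x = \<zero>\<^bsub>M\<^esub>"
    using assms smult_l_distr[of "\<ominus>\<^bsub>R\<^esub> \<one>\<^bsub>R\<^esub>" "\<one>\<^bsub>R\<^esub>" x] by (simp add: R.l_neg)
  then show ?thesis
    using assms by (metis M.minus_equality R.add.inv_closed R.one_closed smult_closed)
qed

text \<open>Negatives are multiples by -1, so closure under inverses follows from closure under
  scalars.\<close>

lemma submoduleI:
  assumes "H \<subseteq> carrier M" "\<zero>\<^bsub>M\<^esub> \<in> H"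
    and "\<And>x y. x \<in> H \<Longrightarrow> y \<in> H \<Longrightarrow> x \<oplus>\<^bsub>M\<^esub> y \<in> H"
    and sm: "\<And>r x. r \<in> carrier R \<Longrightarrow> x \<in> H \<Longrightarrow> r \<odot>\<^bsub>M\<^esub> x \<in> H"
  shows "submodule H R M"
proof -
  have "\<ominus>\<^bsub>M\<^esub> x \<in> H" if "x \<in> H" for x
    using that assms(1) sm[of "\<ominus>\<^bsub>R\<^esub> \<one>\<^bsub>R\<^esub>" x] by (auto simp: minus_eq_smult)
  then show ?thesis
    using assms unfolding submodule_def submodule_axioms_def subgroup_def
    by (simp add: a_inv_def)
qed

lemma submoduleD:
  assumes "submodule H R M"
  shows "H \<subseteq> carrier M" "\<zero>\<^bsub>M\<^esub> \<in> H"
    and "\<And>x y. x \<in> H \<Longrightarrow> y \<in> H \<Longrightarrow> x \<oplus>\<^bsub>M\<^esub> y \<in> H"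
    and "\<And>x. x \<in> H \<Longrightarrow> \<ominus>\<^bsub>M\<^esub> x \<in> H"
    and "\<And>r x. r \<in> carrier R \<Longrightarrow> x \<in> H \<Longrightarrow> r \<odot>\<^bsub>M\<^esub> x \<in> H"
  using assms unfolding submodule_def submodule_axioms_def subgroup_def
  by (auto simp: a_inv_def)

lemma submodule_carrier: "submodule (carrier M) R M"
  by (rule submoduleI) auto

lemma submodule_zero: "submodule {\<zero>\<^bsub>M\<^esub>} R M"
  by (rule submoduleI) auto

lemma submodule_Int:
  "submodule H R M \<Longrightarrow> submodule H' R M \<Longrightarrow> submodule (H \<inter> H') R M"
  by (rule submoduleI) (auto dest: submoduleD)

lemma left_module_submodule:
  assumes H: "submodule H R M"
  shows "left_module R (M\<lparr>carrier := H\<rparr>)"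
proof -
  note D = submoduleD[OF H]
  have sub: "\<And>x. x \<in> H \<Longrightarrow> x \<in> carrier M" using D(1) by blast
  have "abelian_group (M\<lparr>carrier := H\<rparr>)"
  proof (rule abelian_groupI)
    fix x assume "x \<in> carrier (M\<lparr>carrier := H\<rparr>)"
    then show "\<exists>y\<in>carrier (M\<lparr>carrier := H\<rparr>). y \<oplus>\<^bsub>M\<lparr>carrier := H\<rparr>\<^esub> x = \<zero>\<^bsub>M\<lparr>carrier := H\<rparr>\<^esub>"
      using D sub by (intro bexI[of _ "\<ominus>\<^bsub>M\<^esub> x"]) (auto simp: M.l_neg)
  qed (use D sub in \<open>auto simp: M.a_ac\<close>)
  then show ?thesis
    using R.ring_axioms D(5) sub
    by (auto simp: left_module_def left_module_axioms_def smult_l_distr smult_r_distr smult_assoc1)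
qed

text \<open>Lets the length of a submodule be read as the height of a family of submodules of the
  ambient module.\<close>

lemma submodule_restrict_iff:
  assumes H: "submodule H R M"
  shows "submodule C R (M\<lparr>carrier := H\<rparr>) \<longleftrightarrow> submodule C R M \<and> C \<subseteq> H"
proof -
  interpret H: left_module R "M\<lparr>carrier := H\<rparr>" by (rule left_module_submodule[OF H])
  show ?thesis
  proof
    assume "submodule C R (M\<lparr>carrier := H\<rparr>)"
    note D = H.submoduleD[OF this]
    show "submodule C R M \<and> C \<subseteq> H"
      using D submoduleD(1)[OF H] by (auto intro!: submoduleI)
  next
    assume "submodule C R M \<and> C \<subseteq> H"
    then show "submodule C R (M\<lparr>carrier := H\<rparr>)"
      using submoduleD[of C] by (auto intro!: H.submoduleI)
  qed
qed

end

text \<open>Only restricts the record type: the length is not defined for record extensions of modules.\<close>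

locale plain_left_module = left_module R M
  for R :: "('a, 'r) ring_scheme" and M :: "('a, 'm) module" (structure)
begin

lemma length_submodule_eq:
  assumes "submodule H R M"
  shows "module_length R (M\<lparr>carrier := H\<rparr>) = height {C. submodule C R M \<and> C \<subseteq> H}"
  by (simp add: module_length_eq_height submodule_restrict_iff[OF assms])

lemma length_submodule_mono:
  assumes "submodule H R M" "submodule H' R M" "H \<subseteq> H'"
  shows "module_length R (M\<lparr>carrier := H\<rparr>) \<le> module_length R (M\<lparr>carrier := H'\<rparr>)"
  unfolding length_submodule_eq[OF assms(1)] length_submodule_eq[OF assms(2)]
  by (rule height_le_height[where p = id]) (use assms(3) in auto)

lemma length_submodule_le:
  assumes "submodule H R M"
  shows "module_length R (M\<lparr>carrier := H\<rparr>) \<le> module_length R M"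
  unfolding length_submodule_eq[OF assms] unfolding module_length_eq_height
  by (rule height_le_height[where p = id]) auto

lemma length_zero_submodule: "module_length R (M\<lparr>carrier := {\<zero>\<^bsub>M\<^esub>}\<rparr>) = 0"
proof -
  have "n = 0" if "has_chain {C. submodule C R M \<and> C \<subseteq> {\<zero>\<^bsub>M\<^esub>}} n" for n
  proof (rule ccontr)
    assume "n \<noteq> 0"
    then have "has_chain {C. submodule C R M \<and> C \<subseteq> {\<zero>\<^bsub>M\<^esub>}} (Suc 0)"
      using that has_chain_antimono by fastforce
    then obtain C where C: "\<forall>i\<le>Suc 0. submodule (C i) R M \<and> C i \<subseteq> {\<zero>\<^bsub>M\<^esub>}" "C 0 \<subset> C (Suc 0)"
      unfolding has_chain_def by auto
    then have "\<zero>\<^bsub>M\<^esub> \<in> C 0" using submoduleD(2) by blast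
    with C show False by auto
  qed
  then have "height {C. submodule C R M \<and> C \<subseteq> {\<zero>\<^bsub>M\<^esub>}} \<le> 0"
    unfolding height_def by (intro Sup_least) (auto simp: zero_enat_def)
  then show ?thesis
    by (simp add: length_submodule_eq[OF submodule_zero])
qed

text \<open>Chains inside \<open>H\<close> are continued by the family \<open>{H, H'}\<close>, whose
  height is at least 1. This growth is what later bounds the number of basis vectors adjoined to a
  cover.\<close>

lemma length_submodule_strict:
  assumes "submodule H R M" "submodule H' R M" "H \<subset> H'"
  shows "module_length R (M\<lparr>carrier := H\<rparr>) + 1 \<le> module_length R (M\<lparr>carrier := H'\<rparr>)"
proof -
  have "has_chain {H, H'} 1"
    unfolding has_chain_def using assms(3)
    by (intro exI[of _ "\<lambda>i. if i = 0 then H else H'"]) auto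
  then have "1 \<le> height {H, H'}"
    using has_chain_imp_le_height[of "{H, H'}" 1] by (simp add: one_enat_def)
  moreover have "height {C. submodule C R M \<and> C \<subseteq> H} + height {H, H'} \<le>
      height {C. submodule C R M \<and> C \<subseteq> H'}"
    by (rule height_add_le) (use assms in auto)
  ultimately show ?thesis
    unfolding length_submodule_eq[OF assms(1)] length_submodule_eq[OF assms(2)]
    by (meson add_left_mono order_trans)
qed

lemma length_eq_one:
  assumes "carrier M \<noteq> {\<zero>\<^bsub>M\<^esub>}"
    and simple: "\<And>C. submodule C R M \<Longrightarrow> C = {\<zero>\<^bsub>M\<^esub>} \<or> C = carrier M"
  shows "module_length R M = 1"
proof (rule antisym)
  have "\<not> has_chain {C. submodule C R M} 2"
  proof
    assume "has_chain {C. submodule C R M} 2"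
    then obtain C where C: "\<forall>i\<le>2::nat. submodule (C i) R M" "\<forall>i<2. C i \<subset> C (Suc i)"
      unfolding has_chain_def by auto
    then have "C 0 \<subset> C 1" "C 1 \<subset> C 2" "submodule (C 0) R M" "submodule (C 1) R M"
        "submodule (C 2) R M"
      by (auto simp: numeral_2_eq_2)
    moreover from this have "C 0 = {\<zero>\<^bsub>M\<^esub>}" "C 1 = carrier M"
      using simple[of "C 0"] simple[of "C 1"] submoduleD(1,2)[of "C 0"] submoduleD(1,2)[of "C 1"]
        submoduleD(1)[of "C 2"] by auto
    ultimately show False using submoduleD(1)[of "C 2"] by auto
  qed
  then have "n \<le> 1" if "has_chain {C. submodule C R M} n" for n
    using that has_chain_antimono[of _ n 2] by fastforce
  then show "module_length R M \<le> 1"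
    unfolding module_length_eq_height height_def by (auto intro!: Sup_least simp: one_enat_def)
  have "{\<zero>\<^bsub>M\<^esub>} \<subset> carrier M" using assms(1) by auto
  from length_submodule_strict[OF submodule_zero submodule_carrier this]
  show "1 \<le> module_length R M" using length_submodule_le[OF submodule_carrier]
    by (simp add: length_zero_submodule)
qed

end

section \<open>Homomorphisms and additivity of length\<close>

locale left_module_hom = M: plain_left_module R M + N: plain_left_module R N
  for R :: "('a, 'r) ring_scheme" and M :: "('a, 'm) module" and N :: "('a, 'n) module" +
  fixes f
  assumes hom: "f \<in> module_hom R M N"
begin

lemma hom_closed [simp, intro]: "x \<in> carrier M \<Longrightarrow> f x \<in> carrier N"
  and hom_add: "x \<in> carrier M \<Longrightarrow> y \<in> carrier M \<Longrightarrow> f (x \<oplus>\<^bsub>M\<^esub> y) = f x \<oplus>\<^bsub>N\<^esub> f y"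
  and hom_smult: "r \<in> carrier R \<Longrightarrow> x \<in> carrier M \<Longrightarrow> f (r \<odot>\<^bsub>M\<^esub> x) = r \<odot>\<^bsub>N\<^esub> f x"
  using hom unfolding module_hom_def by auto

lemma hom_zero [simp]: "f \<zero>\<^bsub>M\<^esub> = \<zero>\<^bsub>N\<^esub>"
  using hom_smult[of "\<zero>\<^bsub>R\<^esub>" "\<zero>\<^bsub>M\<^esub>"] by simp

lemma hom_minus: "x \<in> carrier M \<Longrightarrow> f (\<ominus>\<^bsub>M\<^esub> x) = \<ominus>\<^bsub>N\<^esub> f x"
  by (simp add: M.minus_eq_smult N.minus_eq_smult hom_smult)

lemma hom_diff: "x \<in> carrier M \<Longrightarrow> y \<in> carrier M \<Longrightarrow> f (x \<ominus>\<^bsub>M\<^esub> y) = f x \<ominus>\<^bsub>N\<^esub> f y"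
  by (simp add: M.minus_eq N.minus_eq hom_add hom_minus)

lemma submodule_image: "submodule C R M \<Longrightarrow> submodule (f ` C) R N"
proof (rule N.submoduleI)
  assume C: "submodule C R M"
  note D = M.submoduleD[OF C]
  then have sub: "\<And>x. x \<in> C \<Longrightarrow> x \<in> carrier M" by blast
  show "f ` C \<subseteq> carrier N" using sub by auto
  show "\<zero>\<^bsub>N\<^esub> \<in> f ` C" using D(2) by (metis hom_zero imageI)
  show "x \<oplus>\<^bsub>N\<^esub> y \<in> f ` C" if "x \<in> f ` C" "y \<in> f ` C" for x y
  proof -
    from that obtain u v where "u \<in> C" "x = f u" "v \<in> C" "y = f v" by blast
    then show ?thesis using hom_add[of u v] D(3)[of u v] sub by (metis imageI)
  qed
  show "r \<odot>\<^bsub>N\<^esub> x \<in> f ` C" if "r \<in> carrier R" "x \<in> f ` C" for r x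
  proof -
    from that obtain u where "u \<in> C" "x = f u" by blast
    then show ?thesis using hom_smult[of r u] D(5)[of r u] sub that by (metis imageI)
  qed
qed

lemma submodule_preimage:
  assumes D: "submodule D R N"
  shows "submodule {x \<in> carrier M. f x \<in> D} R M"
  by (rule M.submoduleI) (use N.submoduleD[OF D] in \<open>auto simp: hom_add hom_smult\<close>)

lemma kernel_eq: "a_kernel M N f = {x \<in> carrier M. f x = \<zero>\<^bsub>N\<^esub>}"
  by (simp add: a_kernel_def')

lemma submodule_kernel: "submodule (a_kernel M N f) R M"
  using submodule_preimage[OF N.submodule_zero] by (simp add: kernel_eq)

lemma diff_in_kernel:
  assumes "x \<in> carrier M" "y \<in> carrier M" "f x = f y"
  shows "x \<ominus>\<^bsub>M\<^esub> y \<in> a_kernel M N f"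
  using assms by (simp add: kernel_eq hom_diff M.minus_closed N.r_neg N.minus_eq)

lemma inj_on_iff_kernel: "inj_on f (carrier M) \<longleftrightarrow> a_kernel M N f = {\<zero>\<^bsub>M\<^esub>}"
proof
  show "a_kernel M N f = {\<zero>\<^bsub>M\<^esub>}" if "inj_on f (carrier M)"
  proof -
    have "x = \<zero>\<^bsub>M\<^esub>" if "x \<in> carrier M" "f x = \<zero>\<^bsub>N\<^esub>" for x
      using \<open>inj_on f (carrier M)\<close> that by (metis M.zero_closed hom_zero inj_onD)
    then show ?thesis by (auto simp: kernel_eq)
  qed
next
  assume k: "a_kernel M N f = {\<zero>\<^bsub>M\<^esub>}"
  show "inj_on f (carrier M)"
  proof (rule inj_onI)
    fix x y assume *: "x \<in> carrier M" "y \<in> carrier M" "f x = f y"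
    then have "x \<ominus>\<^bsub>M\<^esub> y = \<zero>\<^bsub>M\<^esub>" using diff_in_kernel k by blast
    with * show "x = y"
      by (metis M.M.minus_equality M.M.add.inv_closed M.M.minus_eq M.M.minus_minus)
  qed
qed

text \<open>Two inequalities between heights. For the upper bound, \<open>S\<close> is sent to its
  intersection with the kernel and to its image, a pair that separates comparable submodules. For
  the lower bound, a chain inside the kernel is continued by the preimages of a chain in
  \<open>N\<close>, all of which contain the kernel.\<close>

theorem length_eq_kernel_add_image:
  assumes surj: "f ` carrier M = carrier N"
  shows "module_length R M = module_length R (M\<lparr>carrier := a_kernel M N f\<rparr>) + module_length R N"
proof -
  let ?K = "a_kernel M N f"
  let ?F = "{C. submodule C R M}"
  let ?G = "{C. submodule C R M \<and> C \<subseteq> ?K}"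
  let ?H = "{C. submodule C R M \<and> ?K \<subseteq> C}"
  let ?L = "{D. submodule D R N}"
  have "height ?F \<le> height ?G + height ?L"
  proof (rule height_le_add[where p = "\<lambda>C. C \<inter> ?K" and q = "\<lambda>C. f ` C"])
    fix S T assume S: "S \<in> ?F" and T: "T \<in> ?F" and ST: "S \<subseteq> T"
      and eq: "S \<inter> ?K = T \<inter> ?K" "f ` S = f ` T"
    note DS = M.submoduleD[of S] and DT = M.submoduleD[of T]
    have "y \<in> S" if y: "y \<in> T" for y
    proof -
      \<comment> \<open>Modular law: \<open>y\<close> and an element \<open>x\<close> of
        \<open>S\<close> with the same image differ by an element of \<open>T \<inter> ?K\<close>,
        which equals \<open>S \<inter> ?K\<close>.\<close>
      obtain x where x: "x \<in> S" "f x = f y" using eq(2) y by (metis imageE imageI)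
      have carr: "x \<in> carrier M" "y \<in> carrier M" using x(1) y S T DS(1) DT(1) by auto
      have "y \<ominus>\<^bsub>M\<^esub> x \<in> ?K" using diff_in_kernel carr x(2) by simp
      moreover have "y \<ominus>\<^bsub>M\<^esub> x \<in> T"
        using x(1) y ST T DT by (auto simp: M.minus_eq)
      ultimately have "y \<ominus>\<^bsub>M\<^esub> x \<in> S" using eq(1) by blast
      then have "(y \<ominus>\<^bsub>M\<^esub> x) \<oplus>\<^bsub>M\<^esub> x \<in> S" using S DS x(1) by auto
      then show ?thesis using carr by (simp add: M.minus_eq M.a_assoc M.l_neg)
    qed
    with ST show "S = T" by blast
  qed (use submodule_image M.submodule_Int[OF _ submodule_kernel] in auto)
  moreover have "height ?L \<le> height ?H"
  proof (rule height_le_height[where p = "\<lambda>D. {x \<in> carrier M. f x \<in> D}"])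
    fix S T assume *: "S \<in> ?L" "T \<in> ?L" "S \<subset> T"
    then obtain y where y: "y \<in> T" "y \<notin> S" by blast
    then have "y \<in> carrier N" using * N.submoduleD(1) by auto
    then obtain x where "x \<in> carrier M" "f x = y" using surj by (metis imageE)
    with y have "x \<in> {x \<in> carrier M. f x \<in> T}" "x \<notin> {x \<in> carrier M. f x \<in> S}" by auto
    moreover have "{x \<in> carrier M. f x \<in> S} \<subseteq> {x \<in> carrier M. f x \<in> T}" using *(3) by auto
    ultimately show "{x \<in> carrier M. f x \<in> S} \<subset> {x \<in> carrier M. f x \<in> T}" by auto
  qed (use submodule_preimage N.submoduleD(2) in \<open>auto simp: kernel_eq\<close>)
  moreover have "height ?G + height ?H \<le> height ?F"
    by (rule height_add_le) (use submodule_kernel M.submodule_carrier M.submoduleD(1) in auto)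
  ultimately show ?thesis
    unfolding M.length_submodule_eq[OF submodule_kernel] unfolding module_length_eq_height
    by (meson add_left_mono antisym order_trans)
qed

lemma length_eq_if_bij:
  assumes "inj_on f (carrier M)" "f ` carrier M = carrier N"
  shows "module_length R M = module_length R N"
  using length_eq_kernel_add_image[OF assms(2)] assms(1)
  by (simp add: inj_on_iff_kernel M.length_zero_submodule)

lemma length_image_le:
  assumes "f ` carrier M = carrier N"
  shows "module_length R N \<le> module_length R M"
  by (simp add: length_eq_kernel_add_image[OF assms])

lemma restrict_hom:
  assumes "submodule U R M" "submodule V R N" "f ` U \<subseteq> V"
  shows "left_module_hom R (M\<lparr>carrier := U\<rparr>) (N\<lparr>carrier := V\<rparr>) f"
proof (intro left_module_hom.intro left_module_hom_axioms.intro)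
  have U: "x \<in> carrier M" if "x \<in> U" for x using that M.submoduleD(1)[OF assms(1)] by blast
  have V: "f x \<in> V" if "x \<in> U" for x using that assms(3) by blast
  show "f \<in> module_hom R (M\<lparr>carrier := U\<rparr>) (N\<lparr>carrier := V\<rparr>)"
    using U V by (simp add: module_hom_def hom_add hom_smult)
qed (use assms M.left_module_submodule N.left_module_submodule in
    \<open>auto intro: plain_left_module.intro\<close>)

end

lemma left_module_hom_comp:
  assumes "left_module_hom R L M g" "left_module_hom R M N f"
  shows "left_module_hom R L N (\<lambda>x. f (g x))"
proof (intro left_module_hom.intro left_module_hom_axioms.intro)
  interpret g: left_module_hom R L M g by fact
  interpret f: left_module_hom R M N f by fact
  show "(\<lambda>x. f (g x)) \<in> module_hom R L N"
    by (simp add: module_hom_def f.hom_add f.hom_smult g.hom_add g.hom_smult)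
qed (use assms in \<open>simp_all add: left_module_hom_def\<close>)


section \<open>Quotient modules\<close>

lemma left_module_of_surj:
  assumes "plain_left_module R M" and p: "p \<in> module_hom R M Q" "p ` carrier M = carrier Q"
    and p0: "p \<zero>\<^bsub>M\<^esub> = \<zero>\<^bsub>Q\<^esub>"
  shows "plain_left_module R Q"
proof -
  interpret plain_left_module R M by fact
  have pc: "\<And>x. x \<in> carrier M \<Longrightarrow> p x \<in> carrier Q"
    and pa: "\<And>x y. x \<in> carrier M \<Longrightarrow> y \<in> carrier M \<Longrightarrow> p x \<oplus>\<^bsub>Q\<^esub> p y = p (x \<oplus>\<^bsub>M\<^esub> y)"
    and ps: "\<And>r x. r \<in> carrier R \<Longrightarrow> x \<in> carrier M \<Longrightarrow> r \<odot>\<^bsub>Q\<^esub> p x = p (r \<odot>\<^bsub>M\<^esub> x)"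
    using p(1) unfolding module_hom_def by auto
  \<comment> \<open>Each axiom is the image of the corresponding one in \<open>M\<close>. As
    \<open>Q\<close> is not yet a group, there is no cancellation from which preservation of zero
    could be derived; it comes from \<open>p0\<close>.\<close>
  have "abelian_group Q"
  proof (rule abelian_groupI)
    fix u assume "u \<in> carrier Q"
    then obtain x where "x \<in> carrier M" "u = p x" using p(2) by (metis imageE)
    then show "\<exists>v\<in>carrier Q. v \<oplus>\<^bsub>Q\<^esub> u = \<zero>\<^bsub>Q\<^esub>"
      using pc p0 by (intro bexI[of _ "p (\<ominus>\<^bsub>M\<^esub> x)"]) (auto simp: pa M.l_neg)
  qed (auto simp: p(2)[symmetric] p0[symmetric] pa M.a_ac)
  then show ?thesis
    using R.ring_axioms
    by (auto intro!: plain_left_module.intro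
        simp: left_module_def left_module_axioms_def p(2)[symmetric] pa ps
        smult_l_distr smult_r_distr smult_assoc1)
qed

context plain_left_module
begin

lemma module_quot_simps [simp]:
  "\<zero>\<^bsub>module_quot M N\<^esub> = N" "carrier (module_quot M N) = a_rcosets\<^bsub>M\<^esub> N"
  "S \<oplus>\<^bsub>module_quot M N\<^esub> T = S <+>\<^bsub>M\<^esub> T"
  by (simp_all add: module_quot_def)

lemma module_quot_hom:
  assumes N: "submodule N R M"
  shows "left_module_hom R M (module_quot M N) (\<lambda>x. N +>\<^bsub>M\<^esub> x)"
    and "(\<lambda>x. N +>\<^bsub>M\<^esub> x) ` carrier M = carrier (module_quot M N)"
    and "a_kernel M (module_quot M N) (\<lambda>x. N +>\<^bsub>M\<^esub> x) = N"
proof -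
  have sg: "subgroup N (add_monoid M)" using N unfolding submodule_def by simp
  interpret N: abelian_subgroup N M
    by (intro abelian_subgroupI3 additive_subgroupI sg M.abelian_group_axioms)
  note D = submoduleD[OF N]
  have sm: "r \<odot>\<^bsub>module_quot M N\<^esub> (N +>\<^bsub>M\<^esub> x) = N +>\<^bsub>M\<^esub> (r \<odot>\<^bsub>M\<^esub> x)"
    if r: "r \<in> carrier R" and x: "x \<in> carrier M" for r x
  proof -
    \<comment> \<open>The scalar multiple of a coset is a union over its representatives; all of
      them contribute the same coset, so the union collapses.\<close>
    have "N +>\<^bsub>M\<^esub> (r \<odot>\<^bsub>M\<^esub> y) = N +>\<^bsub>M\<^esub> (r \<odot>\<^bsub>M\<^esub> x)" if "y \<in> N +>\<^bsub>M\<^esub> x" for y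
    proof -
      from that obtain n where n: "n \<in> N" "y = n \<oplus>\<^bsub>M\<^esub> x" unfolding a_r_coset_def' by blast
      then have "r \<odot>\<^bsub>M\<^esub> y = r \<odot>\<^bsub>M\<^esub> n \<oplus>\<^bsub>M\<^esub> r \<odot>\<^bsub>M\<^esub> x"
        using D(1) r x by (auto simp: smult_r_distr)
      then have "r \<odot>\<^bsub>M\<^esub> y \<in> N +>\<^bsub>M\<^esub> (r \<odot>\<^bsub>M\<^esub> x)"
        using D(5)[OF r n(1)] unfolding a_r_coset_def' by auto
      then show ?thesis using M.a_repr_independence[OF _ _ sg] r x by (metis smult_closed)
    qed
    moreover have "x \<in> N +>\<^bsub>M\<^esub> x" using N.a_rcos_self x by simp
    ultimately have "(\<Union>y\<in>N +>\<^bsub>M\<^esub> x. N +>\<^bsub>M\<^esub> (r \<odot>\<^bsub>M\<^esub> y)) = N +>\<^bsub>M\<^esub> (r \<odot>\<^bsub>M\<^esub> x)"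
      by blast
    then show ?thesis by (simp add: module_quot_def)
  qed
  have hom: "(\<lambda>x. N +>\<^bsub>M\<^esub> x) \<in> module_hom R M (module_quot M N)"
    using D(1) by (auto simp: module_hom_def sm N.a_rcos_sum M.a_rcosetsI)
  show surj: "(\<lambda>x. N +>\<^bsub>M\<^esub> x) ` carrier M = carrier (module_quot M N)"
    by (auto simp: A_RCOSETS_def')
  have "plain_left_module R (module_quot M N)"
    by (rule left_module_of_surj[OF plain_left_module_axioms hom surj]) (use D(1) in auto)
  then interpret Q: plain_left_module R "module_quot M N" .
  show "left_module_hom R M (module_quot M N) (\<lambda>x. N +>\<^bsub>M\<^esub> x)"
    by unfold_locales (rule hom)
  show "a_kernel M (module_quot M N) (\<lambda>x. N +>\<^bsub>M\<^esub> x) = N"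
    using D(1) M.a_coset_join1[OF _ _ sg] M.a_coset_join2[OF _ sg]
    by (auto simp: a_kernel_def')
qed

lemma length_quot:
  assumes "submodule N R M"
  shows "module_length R M = module_length R (M\<lparr>carrier := N\<rparr>) + module_length R (module_quot M N)"
  using left_module_hom.length_eq_kernel_add_image[OF module_quot_hom(1,2)[OF assms]]
  by (simp add: module_quot_hom(3)[OF assms])

end


subsection \<open>The radical and the submodule it generates\<close>

lemma regular_module_simps [simp]:
  "carrier (regular_module R) = carrier R" "\<zero>\<^bsub>regular_module R\<^esub> = \<zero>\<^bsub>R\<^esub>"
  "x \<oplus>\<^bsub>regular_module R\<^esub> y = x \<oplus>\<^bsub>R\<^esub> y" "r \<odot>\<^bsub>regular_module R\<^esub> x = r \<otimes>\<^bsub>R\<^esub> x"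
  by (simp_all add: regular_module_def)

lemma (in ring) plain_left_module_regular: "plain_left_module R (regular_module R)"
proof -
  have "abelian_group (regular_module R)"
  proof (rule abelian_groupI)
    fix x assume "x \<in> carrier (regular_module R)"
    then show "\<exists>y\<in>carrier (regular_module R). y \<oplus>\<^bsub>regular_module R\<^esub> x = \<zero>\<^bsub>regular_module R\<^esub>"
      by (intro bexI[of _ "\<ominus> x"]) (auto simp: l_neg)
  qed (auto simp: a_ac)
  then show ?thesis
    using ring_axioms
    by (auto intro!: plain_left_module.intro simp: left_module_def left_module_axioms_def l_distr r_distr m_assoc)
qed

lemma (in ring) submodule_radical: "submodule (radical R) R (regular_module R)"
proof -
  interpret plain_left_module R "regular_module R" by (rule plain_left_module_regular)
  have sub: "submodule I R (regular_module R)" if "maximal_left_ideal R I" for I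
    using that unfolding maximal_left_ideal_def by blast
  show ?thesis
    unfolding radical_def
    by (rule submoduleI)
      (use submoduleD(2)[OF sub] submoduleD(3)[OF sub] submoduleD(5)[OF sub] in auto)
qed

lemma (in ring) radical_subset: "radical R \<subseteq> carrier R"
  by (auto simp: radical_def)

context plain_left_module
begin

lemma rad_mult_incl: "j \<in> radical R \<Longrightarrow> x \<in> carrier M \<Longrightarrow> j \<odot>\<^bsub>M\<^esub> x \<in> rad_mult R M"
  unfolding rad_mult_def by (rule generate.incl) auto

lemma rad_mult_least:
  assumes "submodule H R M" "\<And>j x. j \<in> radical R \<Longrightarrow> x \<in> carrier M \<Longrightarrow> j \<odot>\<^bsub>M\<^esub> x \<in> H"
  shows "rad_mult R M \<subseteq> H"
  unfolding rad_mult_def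
  by (rule M.add.generate_subgroup_incl) (use assms in \<open>auto simp: submodule_def\<close>)

text \<open>\<open>rad_mult\<close> is generated as an additive group. Scalars preserve it because
  the radical is a left ideal and absorbs \<open>r\<close> into its own factor.\<close>

lemma submodule_rad_mult: "submodule (rad_mult R M) R M"
proof -
  interpret A: plain_left_module R "regular_module R" by (rule R.plain_left_module_regular)
  let ?S = "{j \<odot>\<^bsub>M\<^esub> x | j x. j \<in> radical R \<and> x \<in> carrier M}"
  have S: "?S \<subseteq> carrier M" using R.radical_subset by auto
  have sg: "subgroup (rad_mult R M) (add_monoid M)"
    unfolding rad_mult_def by (rule M.add.generate_is_subgroup) (use S in auto)
  have carr: "x \<in> carrier M" if "x \<in> generate (add_monoid M) ?S" for x
    using sg that unfolding rad_mult_def subgroup_def by auto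
  have "r \<odot>\<^bsub>M\<^esub> x \<in> rad_mult R M" if r: "r \<in> carrier R" and x: "x \<in> rad_mult R M" for r x
    using x unfolding rad_mult_def
  proof (induction x rule: generate.induct)
    case one
    then show ?case using r generate.one[of "add_monoid M"] by simp
  next
    case (incl h)
    then obtain j x where jx: "h = j \<odot>\<^bsub>M\<^esub> x" "j \<in> radical R" "x \<in> carrier M" by blast
    then have "r \<odot>\<^bsub>M\<^esub> h = (r \<otimes>\<^bsub>R\<^esub> j) \<odot>\<^bsub>M\<^esub> x"
      using r R.radical_subset by (auto simp: smult_assoc1)
    moreover have "r \<otimes>\<^bsub>R\<^esub> j \<in> radical R"
      using A.submoduleD(5)[OF R.submodule_radical r jx(2)] by simp
    ultimately show ?case using jx(3) by (auto intro!: generate.incl)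
  next
    case (inv h)
    then obtain j x where jx: "h = j \<odot>\<^bsub>M\<^esub> x" "j \<in> radical R" "x \<in> carrier M" by blast
    \<comment> \<open>Moving the sign to \<open>x\<close> shows that the inverse of a generator is
      again a generator.\<close>
    then have "r \<odot>\<^bsub>M\<^esub> (inv\<^bsub>add_monoid M\<^esub> h) = r \<odot>\<^bsub>M\<^esub> (j \<odot>\<^bsub>M\<^esub> (\<ominus>\<^bsub>M\<^esub> x))"
      using R.radical_subset by (auto simp: smult_r_minus a_inv_def[symmetric])
    also have "\<dots> = (r \<otimes>\<^bsub>R\<^esub> j) \<odot>\<^bsub>M\<^esub> (\<ominus>\<^bsub>M\<^esub> x)"
      using r jx R.radical_subset by (auto simp: smult_assoc1)
    finally have "r \<odot>\<^bsub>M\<^esub> (inv\<^bsub>add_monoid M\<^esub> h) = (r \<otimes>\<^bsub>R\<^esub> j) \<odot>\<^bsub>M\<^esub> (\<ominus>\<^bsub>M\<^esub> x)" .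
    moreover have "r \<otimes>\<^bsub>R\<^esub> j \<in> radical R"
      using A.submoduleD(5)[OF R.submodule_radical r jx(2)] by simp
    ultimately show ?case using jx(3) by (auto intro!: generate.incl)
  next
    case (eng h1 h2)
    then have "r \<odot>\<^bsub>M\<^esub> (h1 \<oplus>\<^bsub>M\<^esub> h2) = r \<odot>\<^bsub>M\<^esub> h1 \<oplus>\<^bsub>M\<^esub> r \<odot>\<^bsub>M\<^esub> h2"
      using r carr by (simp add: smult_r_distr)
    with eng.IH show ?case using generate.eng by fastforce
  qed
  with sg show ?thesis
    by (simp add: submodule_def submodule_axioms_def)
qed

text \<open>\<open>top_length\<close> passes through \<open>the_enat\<close>; finite length
  guarantees that it is the true length of M/JM.\<close>

lemma length_eq_rad_add_top:
  assumes "module_length R M < \<infinity>"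
  shows "module_length R M =
    module_length R (M\<lparr>carrier := rad_mult R M\<rparr>) + enat (top_length R M)"
proof -
  have * : "module_length R M = module_length R (M\<lparr>carrier := rad_mult R M\<rparr>) +
      module_length R (module_quot M (rad_mult R M))"
    using length_quot[OF submodule_rad_mult] .
  have "module_length R (module_quot M (rad_mult R M)) \<noteq> \<infinity>"
  proof
    assume "module_length R (module_quot M (rad_mult R M)) = \<infinity>"
    with * assms show False by simp
  qed
  with * show ?thesis unfolding top_length_def by (metis not_infinity_eq the_enat.simps)
qed

end

text \<open>Applied to a free cover of M it presents JM as the image of JF; applied to a copy of the
  syzygy inside F it compares the two radicals.\<close>

lemma (in left_module_hom) image_rad_mult:
  assumes "f ` carrier M = carrier N"
  shows "f ` rad_mult R M = rad_mult R N"
proof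
  have "rad_mult R M \<subseteq> {x \<in> carrier M. f x \<in> rad_mult R N}"
    using M.R.radical_subset
    by (intro M.rad_mult_least submodule_preimage N.submodule_rad_mult)
      (auto simp: hom_smult N.rad_mult_incl)
  then show "f ` rad_mult R M \<subseteq> rad_mult R N" by blast
next
  show "rad_mult R N \<subseteq> f ` rad_mult R M"
  proof (rule N.rad_mult_least)
    show "submodule (f ` rad_mult R M) R N"
      by (rule submodule_image[OF M.submodule_rad_mult])
    fix j y assume j: "j \<in> radical R" and "y \<in> carrier N"
    then obtain x where "x \<in> carrier M" "y = f x" using assms by (metis imageE)
    with j show "j \<odot>\<^bsub>N\<^esub> y \<in> f ` rad_mult R M"
      using M.rad_mult_incl[of j x] hom_smult[of j x] M.R.radical_subset
      by (metis imageI subsetD)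
  qed
qed


section \<open>Free modules\<close>

text \<open>One ambient module in which the free modules of all finite ranks and their multiples by
  J and J^2 are submodules, on the carrier type over which \<open>projective\<close>
  quantifies.\<close>

definition fun_module :: "('a, 'z) ring_scheme \<Rightarrow> 'a umodule" where
  "fun_module R = \<lparr>carrier = {x. \<forall>i. x i \<in> carrier R}, monoid.mult = (\<lambda>x y. x), one = (\<lambda>i. \<one>\<^bsub>R\<^esub>),
     ring.zero = (\<lambda>i. \<zero>\<^bsub>R\<^esub>), ring.add = (\<lambda>x y i. x i \<oplus>\<^bsub>R\<^esub> y i), smult = (\<lambda>r x i. r \<otimes>\<^bsub>R\<^esub> x i)\<rparr>"

text \<open>For \<open>V\<close> equal to R, J or J^2 these are F, JF and J^2 F, with F free on
  \<open>I\<close>. Index sets in place of ranks allow a basis vector to be removed or adjoined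
  without renumbering.\<close>

definition vectors :: "('a, 'z) ring_scheme \<Rightarrow> nat set \<Rightarrow> 'a set \<Rightarrow> (nat \<Rightarrow> 'a) set" where
  "vectors R I V = {x. \<forall>i. if i \<in> I then x i \<in> V else x i = \<zero>\<^bsub>R\<^esub>}"

definition unit_vec :: "('a, 'z) ring_scheme \<Rightarrow> nat \<Rightarrow> nat \<Rightarrow> 'a" where
  "unit_vec R i = (\<lambda>j. if j = i then \<one>\<^bsub>R\<^esub> else \<zero>\<^bsub>R\<^esub>)"

definition free_module :: "('a, 'z) ring_scheme \<Rightarrow> nat set \<Rightarrow> 'a umodule" where
  "free_module R I = (fun_module R)\<lparr>carrier := vectors R I (carrier R)\<rparr>"

lemma fun_module_simps [simp]:
  "\<zero>\<^bsub>fun_module R\<^esub> = (\<lambda>i. \<zero>\<^bsub>R\<^esub>)" "carrier (fun_module R) = {x. \<forall>i. x i \<in> carrier R}"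
  "x \<oplus>\<^bsub>fun_module R\<^esub> y = (\<lambda>i. x i \<oplus>\<^bsub>R\<^esub> y i)" "r \<odot>\<^bsub>fun_module R\<^esub> x = (\<lambda>i. r \<otimes>\<^bsub>R\<^esub> x i)"
  by (simp_all add: fun_module_def)

lemma free_module_simps [simp]:
  "\<zero>\<^bsub>free_module R I\<^esub> = (\<lambda>i. \<zero>\<^bsub>R\<^esub>)" "carrier (free_module R I) = vectors R I (carrier R)"
  "x \<oplus>\<^bsub>free_module R I\<^esub> y = (\<lambda>i. x i \<oplus>\<^bsub>R\<^esub> y i)" "r \<odot>\<^bsub>free_module R I\<^esub> x = (\<lambda>i. r \<otimes>\<^bsub>R\<^esub> x i)"
  by (simp_all add: free_module_def)

lemma free_module_restrict:
  "(free_module R I)\<lparr>carrier := S\<rparr> = (fun_module R)\<lparr>carrier := S\<rparr>"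
  by (simp add: free_module_def)

context ring
begin

lemma plain_left_module_fun: "plain_left_module R (fun_module R)"
proof -
  have "abelian_group (fun_module R)"
  proof (rule abelian_groupI)
    fix x assume "x \<in> carrier (fun_module R)"
    then show "\<exists>y\<in>carrier (fun_module R). y \<oplus>\<^bsub>fun_module R\<^esub> x = \<zero>\<^bsub>fun_module R\<^esub>"
      by (intro bexI[of _ "\<lambda>i. \<ominus> x i"]) (auto simp: l_neg)
  qed (auto simp: a_ac)
  then show ?thesis
    using ring_axioms
    by (auto intro!: plain_left_module.intro
        simp: left_module_def left_module_axioms_def l_distr r_distr m_assoc)
qed

lemma submodule_vectors:
  assumes "submodule V R (regular_module R)"
  shows "submodule (vectors R I V) R (fun_module R)"
proof -
  interpret A: plain_left_module R "regular_module R" by (rule plain_left_module_regular)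
  interpret F: plain_left_module R "fun_module R" by (rule plain_left_module_fun)
  note D = A.submoduleD[OF assms]
  show ?thesis
  proof (rule F.submoduleI)
    show "vectors R I V \<subseteq> carrier (fun_module R)"
    proof
      fix x assume x: "x \<in> vectors R I V"
      have "x i \<in> carrier R" for i
        using x D(1) by (cases "i \<in> I") (auto simp: vectors_def)
      then show "x \<in> carrier (fun_module R)" by simp
    qed
  qed (use D(2,3,5) in \<open>auto simp: vectors_def\<close>)
qed

lemma submodule_regular_carrier: "submodule (carrier R) R (regular_module R)"
  using left_module.submodule_carrier[of R "regular_module R"] plain_left_module_regular
  by (simp add: plain_left_module_def)

lemma plain_left_module_free: "plain_left_module R (free_module R I)"
  unfolding free_module_def
  using left_module.left_module_submodule[OF _ submodule_vectors[OF submodule_regular_carrier]]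
    plain_left_module_fun
  by (auto simp: plain_left_module_def)

lemma vectors_mono:
  assumes "K \<subseteq> I" "V \<subseteq> W" "\<zero> \<in> W"
  shows "vectors R K V \<subseteq> vectors R I W"
proof
  fix x assume x: "x \<in> vectors R K V"
  have "if j \<in> I then x j \<in> W else x j = \<zero>" for j
    using x assms by (cases "j \<in> K") (auto simp: vectors_def)
  then show "x \<in> vectors R I W" by (simp add: vectors_def)
qed

lemma vectors_insert_zero:
  assumes "i \<notin> I" "\<zero> \<in> V"
  shows "{x \<in> vectors R (insert i I) V. x i = \<zero>} = vectors R I V"
proof (intro equalityI subsetI)
  fix x assume "x \<in> {x \<in> vectors R (insert i I) V. x i = \<zero>}"
  then have x: "x \<in> vectors R (insert i I) V" "x i = \<zero>" by auto
  have "if j \<in> I then x j \<in> V else x j = \<zero>" for j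
    using x assms by (cases "j = i") (auto simp: vectors_def)
  then show "x \<in> vectors R I V" by (simp add: vectors_def)
next
  fix x assume "x \<in> vectors R I V"
  then show "x \<in> {x \<in> vectors R (insert i I) V. x i = \<zero>}"
    using vectors_mono[of I "insert i I" V V] assms by (auto simp: vectors_def)
qed

lemma submodule_vectors_free:
  assumes "submodule V R (regular_module R)" "K \<subseteq> I"
  shows "submodule (vectors R K V) R (free_module R I)"
proof -
  interpret A: plain_left_module R "regular_module R" by (rule plain_left_module_regular)
  interpret F: plain_left_module R "fun_module R" by (rule plain_left_module_fun)
  have "vectors R K V \<subseteq> vectors R I (carrier R)"
    using A.submoduleD(1)[OF assms(1)] assms(2) by (intro vectors_mono) auto
  then show ?thesis
    unfolding free_module_def
    by (simp add: F.submodule_restrict_iff submodule_vectors submodule_regular_carrier assms)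
qed

text \<open>Projection to one coordinate is onto \<open>V\<close>, and its kernel consists of the
  vectors on the remaining indices, so each index contributes \<open>v\<close>.\<close>

lemma length_vectors:
  assumes "finite I" and V: "submodule V R (regular_module R)"
    and v: "module_length R ((regular_module R)\<lparr>carrier := V\<rparr>) = enat v"
  shows "module_length R ((fun_module R)\<lparr>carrier := vectors R I V\<rparr>) = enat (card I * v)"
  using \<open>finite I\<close>
proof (induction I rule: finite_induct)
  case empty
  interpret F: plain_left_module R "fun_module R" by (rule plain_left_module_fun)
  have "vectors R {} V = {\<zero>\<^bsub>fun_module R\<^esub>}" by (auto simp: vectors_def)
  then show ?case by (metis F.length_zero_submodule card.empty mult_0 zero_enat_def)
next
  case (insert i I)
  interpret A: plain_left_module R "regular_module R" by (rule plain_left_module_regular)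
  interpret F: plain_left_module R "fun_module R" by (rule plain_left_module_fun)
  let ?M = "(fun_module R)\<lparr>carrier := vectors R (insert i I) V\<rparr>"
  let ?N = "(regular_module R)\<lparr>carrier := V\<rparr>"
  let ?p = "\<lambda>x :: nat \<Rightarrow> 'a. x i"
  have "?p \<in> module_hom R ?M ?N"
    by (auto simp: module_hom_def vectors_def)
  then interpret p: left_module_hom R ?M ?N ?p
    by (intro left_module_hom.intro left_module_hom_axioms.intro plain_left_module.intro
        F.left_module_submodule A.left_module_submodule submodule_vectors V)
  have "?p ` carrier ?M = carrier ?N"
  proof (intro equalityI subsetI)
    fix r assume "r \<in> carrier ?N"
    then have "(\<lambda>j. if j = i then r else \<zero>) \<in> carrier ?M"
      using A.submoduleD(2)[OF V] by (auto simp: vectors_def)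
    then show "r \<in> ?p ` carrier ?M" by (rule rev_image_eqI) simp
  qed (auto simp: vectors_def)
  moreover have "a_kernel ?M ?N ?p = vectors R I V"
    using vectors_insert_zero[OF insert.hyps(2)] A.submoduleD(2)[OF V] by (simp add: p.kernel_eq)
  ultimately show ?case
    using p.length_eq_kernel_add_image insert v by simp
qed

text \<open>Splits off one coordinate at a time. The multiples of unit vectors are required only for
  \<open>v\<close> in \<open>V\<close>, so that JF and J^2 F are covered, which need not contain the
  unit vectors themselves.\<close>

lemma vectors_span:
  assumes "finite K" "V \<subseteq> carrier R" "(\<lambda>i. \<zero>) \<in> H"
    and add: "\<And>x y. x \<in> H \<Longrightarrow> y \<in> H \<Longrightarrow> (\<lambda>i. x i \<oplus> y i) \<in> H"
    and gen: "\<And>i v. i \<in> K \<Longrightarrow> v \<in> V \<Longrightarrow> (\<lambda>j. v \<otimes> unit_vec R i j) \<in> H"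
  shows "vectors R K V \<subseteq> H"
  using assms(1) gen
proof (induction K rule: finite_induct)
  case empty
  have "x = (\<lambda>i. \<zero>)" if "x \<in> vectors R {} V" for x using that by (auto simp: vectors_def)
  then show ?case using assms(3) by auto
next
  case (insert i K)
  show ?case
  proof
    fix x assume x: "x \<in> vectors R (insert i K) V"
    have xi: "x i \<in> V" using x by (auto simp: vectors_def)
    have xj: "x j \<in> carrier R" for j
      using x assms(2) by (cases "j \<in> insert i K") (auto simp: vectors_def)
    have "x(i := \<zero>) \<in> vectors R K V"
      using x insert.hyps by (auto simp: vectors_def)
    then have "x(i := \<zero>) \<in> H" using insert by auto
    from add[OF this insert.prems[OF _ xi]]
    have "(\<lambda>j. (x(i := \<zero>)) j \<oplus> x i \<otimes> unit_vec R i j) \<in> H" by simp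
    moreover have "(\<lambda>j. (x(i := \<zero>)) j \<oplus> x i \<otimes> unit_vec R i j) = x"
      using xj by (auto simp: unit_vec_def)
    ultimately show "x \<in> H" by simp
  qed
qed

section \<open>Homomorphisms out of free modules\<close>

lemma unit_vec_in_vectors: "i \<in> I \<Longrightarrow> unit_vec R i \<in> vectors R I (carrier R)"
  by (auto simp: vectors_def unit_vec_def)

text \<open>Adjoining one basis vector at a time avoids finite sums in \<open>M\<close> and lets a
  cover be enlarged while its image is tracked.\<close>

lemma free_hom_extend:
  assumes h: "left_module_hom R (free_module R I) M h" and i: "i \<notin> I" and y: "y \<in> carrier M"
  obtains h' where "left_module_hom R (free_module R (insert i I)) M h'" "h' (unit_vec R i) = y"
    "\<And>x. x \<in> vectors R I (carrier R) \<Longrightarrow> h' x = h x"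
proof
  interpret h: left_module_hom R "free_module R I" M h by fact
  define h' where "h' = (\<lambda>x. h (x(i := \<zero>)) \<oplus>\<^bsub>M\<^esub> x i \<odot>\<^bsub>M\<^esub> y)"
  have 1: "x(i := \<zero>) \<in> carrier (free_module R I)" "x i \<in> carrier R"
    if "x \<in> vectors R (insert i I) (carrier R)" for x
    using that i by (auto simp: vectors_def)
  have "h' \<in> module_hom R (free_module R (insert i I)) M"
    unfolding module_hom_def
  proof (intro CollectI conjI ballI funcsetI)
    fix x assume x: "x \<in> carrier (free_module R (insert i I))"
    then show "h' x \<in> carrier M"
      using h.hom_closed[of "x(i := \<zero>)"] 1[of x] y unfolding h'_def by simp
  next
    fix x z assume x: "x \<in> carrier (free_module R (insert i I))"
      and z: "z \<in> carrier (free_module R (insert i I))"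
    have "(x \<oplus>\<^bsub>free_module R (insert i I)\<^esub> z)(i := \<zero>) =
        x(i := \<zero>) \<oplus>\<^bsub>free_module R I\<^esub> z(i := \<zero>)" by auto
    then have "h' (x \<oplus>\<^bsub>free_module R (insert i I)\<^esub> z) =
        (h (x(i := \<zero>)) \<oplus>\<^bsub>M\<^esub> h (z(i := \<zero>))) \<oplus>\<^bsub>M\<^esub> (x i \<oplus> z i) \<odot>\<^bsub>M\<^esub> y"
      using h.hom_add[of "x(i := \<zero>)" "z(i := \<zero>)"] 1 x z unfolding h'_def by simp
    also have "\<dots> = h' x \<oplus>\<^bsub>M\<^esub> h' z"
      using 1[of x] 1[of z] x z y h.hom_closed
      unfolding h'_def by (simp add: h.N.smult_l_distr h.N.M.a_ac)
    finally show "h' (x \<oplus>\<^bsub>free_module R (insert i I)\<^esub> z) = h' x \<oplus>\<^bsub>M\<^esub> h' z" .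
  next
    fix r x assume r: "r \<in> carrier R" and x: "x \<in> carrier (free_module R (insert i I))"
    have "(r \<odot>\<^bsub>free_module R (insert i I)\<^esub> x)(i := \<zero>) = r \<odot>\<^bsub>free_module R I\<^esub> (x(i := \<zero>))"
      using r by auto
    then have "h' (r \<odot>\<^bsub>free_module R (insert i I)\<^esub> x) = r \<odot>\<^bsub>M\<^esub> h (x(i := \<zero>)) \<oplus>\<^bsub>M\<^esub> (r \<otimes> x i) \<odot>\<^bsub>M\<^esub> y"
      using h.hom_smult[OF r, of "x(i := \<zero>)"] 1 x unfolding h'_def by simp
    also have "\<dots> = r \<odot>\<^bsub>M\<^esub> h' x"
      using 1[of x] x y r h.hom_closed
      unfolding h'_def by (simp add: h.N.smult_r_distr h.N.smult_assoc1)
    finally show "h' (r \<odot>\<^bsub>free_module R (insert i I)\<^esub> x) = r \<odot>\<^bsub>M\<^esub> h' x" .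
  qed
  then show "left_module_hom R (free_module R (insert i I)) M h'"
    by (intro left_module_hom.intro left_module_hom_axioms.intro plain_left_module_free
        h.N.plain_left_module_axioms)
  have "(unit_vec R i)(i := \<zero>) = (\<lambda>j. \<zero>)" by (auto simp: unit_vec_def)
  then show "h' (unit_vec R i) = y"
    using h.hom_zero y unfolding h'_def by (simp add: unit_vec_def)
  show "h' x = h x" if "x \<in> vectors R I (carrier R)" for x
  proof -
    have "x i = \<zero>" "x(i := \<zero>) = x" using that i by (auto simp: vectors_def)
    then show ?thesis using h.hom_closed[of x] that y unfolding h'_def by simp
  qed
qed

lemma zero_free_hom:
  assumes "plain_left_module R M"
  shows "left_module_hom R (free_module R I) M (\<lambda>x. \<zero>\<^bsub>M\<^esub>)"
proof -
  interpret plain_left_module R M by fact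
  show ?thesis
    by (intro left_module_hom.intro left_module_hom_axioms.intro plain_left_module_free assms)
      (auto simp: module_hom_def)
qed

lemma free_hom_exists:
  assumes "finite I" "plain_left_module R M" "\<And>i. i \<in> I \<Longrightarrow> m i \<in> carrier M"
  shows "\<exists>h. left_module_hom R (free_module R I) M h \<and> (\<forall>i\<in>I. h (unit_vec R i) = m i)"
  using assms(1,3)
proof (induction I rule: finite_induct)
  case empty
  then show ?case using zero_free_hom[OF assms(2)] by blast
next
  case (insert i I)
  then obtain h where h: "left_module_hom R (free_module R I) M h" "\<forall>i\<in>I. h (unit_vec R i) = m i"
    by auto
  obtain h' where h': "left_module_hom R (free_module R (insert i I)) M h'" "h' (unit_vec R i) = m i"
      "\<And>x. x \<in> vectors R I (carrier R) \<Longrightarrow> h' x = h x"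
    using free_hom_extend[OF h(1) insert.hyps(2)] insert.prems by (metis insertI1)
  then have "\<forall>j\<in>insert i I. h' (unit_vec R j) = m j"
    using h(2) unit_vec_in_vectors by auto
  with h' show ?case by blast
qed

lemma free_hom_eqI:
  assumes "left_module_hom R (free_module R I) M f" "left_module_hom R (free_module R I) M g"
    and "finite I" and eq: "\<And>i. i \<in> I \<Longrightarrow> f (unit_vec R i) = g (unit_vec R i)"
    and x: "x \<in> vectors R I (carrier R)"
  shows "f x = g x"
proof -
  interpret f: left_module_hom R "free_module R I" M f by fact
  interpret g: left_module_hom R "free_module R I" M g by fact
  let ?H = "{x \<in> carrier (free_module R I). f x = g x}"
  have "vectors R I (carrier R) \<subseteq> ?H"
  proof (rule vectors_span)
    show "(\<lambda>i. \<zero>) \<in> ?H"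
      using f.hom_zero g.hom_zero f.M.M.zero_closed by simp
    show "(\<lambda>i. x i \<oplus> y i) \<in> ?H" if "x \<in> ?H" "y \<in> ?H" for x y
      using that f.hom_add[of x y] g.hom_add[of x y] f.M.M.a_closed[of x y] by simp
    show "(\<lambda>j. v \<otimes> unit_vec R i j) \<in> ?H" if "i \<in> I" "v \<in> carrier R" for i v
      using that f.hom_smult[of v "unit_vec R i"] g.hom_smult[of v "unit_vec R i"] eq
        f.M.smult_closed[of v "unit_vec R i"] unit_vec_in_vectors[of i I] by simp
  qed (use assms in auto)
  with x show ?thesis by auto
qed

text \<open>While the image is proper, one more basis vector is sent to an element outside it, and
  the length of the image grows by at least 1. The finite length of \<open>M\<close> stops
  this.\<close>

lemma free_cover_exists:
  fixes M :: "('a, 'm) module"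
  assumes M: "plain_left_module R M" and fin: "module_length R M < \<infinity>"
  obtains I h where "finite I" "left_module_hom R (free_module R I) M h"
    "h ` vectors R I (carrier R) = carrier M"
proof -
  interpret M: plain_left_module R M by fact
  let ?im = "\<lambda>I h. h ` carrier (free_module R I)"
  have "\<exists>I h. finite I \<and> left_module_hom R (free_module R I) M h \<and>
      (?im I h = carrier M \<or> enat n \<le> module_length R (M\<lparr>carrier := ?im I h\<rparr>))" for n
  proof (induction n)
    case 0
    then show ?case
      using zero_free_hom[OF M, of "{}"] by (metis finite.emptyI zero_enat_def zero_le)
  next
    case (Suc n)
    then obtain I h where I: "finite I" and h: "left_module_hom R (free_module R I) M h"
      and or: "?im I h = carrier M \<or> enat n \<le> module_length R (M\<lparr>carrier := ?im I h\<rparr>)" by blast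
    interpret h: left_module_hom R "free_module R I" M h by fact
    show ?case
    proof (cases "?im I h = carrier M")
      case False
      then obtain y where y: "y \<in> carrier M" "y \<notin> ?im I h" using h.hom_closed by blast
      obtain i where i: "i \<notin> I" using I ex_new_if_finite infinite_UNIV_nat by blast
      obtain h' where h': "left_module_hom R (free_module R (insert i I)) M h'" "h' (unit_vec R i) = y"
          "\<And>x. x \<in> vectors R I (carrier R) \<Longrightarrow> h' x = h x"
        using free_hom_extend[OF h i y(1)] by metis
      interpret h': left_module_hom R "free_module R (insert i I)" M h' by fact
      have "vectors R I (carrier R) \<subseteq> vectors R (insert i I) (carrier R)"
        by (intro vectors_mono) auto
      then have "?im I h \<subseteq> ?im (insert i I) h'" using h'(3) by force
      moreover have "y \<in> ?im (insert i I) h'"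
        using h'(2) unit_vec_in_vectors[of i "insert i I"] by auto
      ultimately have "?im I h \<subset> ?im (insert i I) h'" using y(2) by blast
      then have "module_length R (M\<lparr>carrier := ?im I h\<rparr>) + 1 \<le>
          module_length R (M\<lparr>carrier := ?im (insert i I) h'\<rparr>)"
        by (intro M.length_submodule_strict h.submodule_image h'.submodule_image
            h.M.submodule_carrier h'.M.submodule_carrier)
      moreover have "enat (Suc n) \<le> module_length R (M\<lparr>carrier := ?im I h\<rparr>) + 1"
        using or False by (metis Suc_eq_plus1 add_right_mono one_enat_def plus_enat_simps(1))
      ultimately show ?thesis using I h'(1) by (meson finite_insert order_trans)
    qed (use I h in blast)
  qed
  \<comment> \<open>The stage \<open>Suc n\<close>, one beyond the length of \<open>M\<close>, rules
    out the second alternative.\<close>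
  moreover obtain n where n: "module_length R M = enat n" using fin by auto
  ultimately obtain I h where I: "finite I" and h: "left_module_hom R (free_module R I) M h"
    and or: "?im I h = carrier M \<or> enat (Suc n) \<le> module_length R (M\<lparr>carrier := ?im I h\<rparr>)"
    by blast
  interpret h: left_module_hom R "free_module R I" M h by fact
  have "module_length R (M\<lparr>carrier := ?im I h\<rparr>) \<le> enat n"
    using M.length_submodule_le[OF h.submodule_image[OF h.M.submodule_carrier]] n by simp
  then have "\<not> enat (Suc n) \<le> module_length R (M\<lparr>carrier := ?im I h\<rparr>)"
    by (metis Suc_n_not_le_n enat_ord_simps(1) order_trans)
  with or I h that show ?thesis by simp
qed

end


section \<open>Projective covers over a local ring with nilpotent radical\<close>

text \<open>What the length count uses of the algebra, with the base field forgotten. Since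
  \<open>radical\<close> is an intersection of left ideals, its being two-sided is an assumption
  here. Left inverses are the kind that elimination in left modules calls for.\<close>

locale short_local_ring = ring R for R :: "('a, 'z) ring_scheme" (structure) +
  fixes e a :: nat
  assumes ideal_radical: "ideal (radical R) R"
    and one_notin_radical: "\<one> \<notin> radical R"
    and ex_left_inverse: "r \<in> carrier R \<Longrightarrow> r \<notin> radical R \<Longrightarrow> \<exists>s\<in>carrier R. s \<otimes> r = \<one>"
    and radical_cube: "v \<in> radical R \<cdot> radical R \<Longrightarrow> j \<in> radical R \<Longrightarrow> v \<otimes> j = \<zero>"
    and length_radical_quot:
      "module_length R (module_quot ((regular_module R)\<lparr>carrier := radical R\<rparr>)
         (radical R \<cdot> radical R)) = enat e"
    and length_radical_square:
      "module_length R ((regular_module R)\<lparr>carrier := radical R \<cdot> radical R\<rparr>) = enat a"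
begin

abbreviation J where "J \<equiv> radical R"
abbreviation J2 where "J2 \<equiv> radical R \<cdot> radical R"

sublocale A: plain_left_module R "regular_module R"
  by (rule plain_left_module_regular)

sublocale J: ideal J R
  by (rule ideal_radical)

sublocale J2: ideal J2 R
  by (rule ideal_prod_is_ideal[OF ideal_radical ideal_radical])

lemma submodule_radical_square: "submodule J2 R (regular_module R)"
  by (rule A.submoduleI) (auto simp: J2.I_l_closed)

lemma radical_square_subset: "J2 \<subseteq> J"
  using ideal_prod_inter[OF ideal_radical ideal_radical] by blast

lemma submodule_eq_carrier:
  assumes "submodule H R (regular_module R)" "r \<in> H" "r \<notin> J"
  shows "H = carrier R"
proof -
  note D = A.submoduleD[OF assms(1)]
  have r: "r \<in> carrier R" using D(1) assms(2) by auto
  obtain s where "s \<in> carrier R" "s \<otimes> r = \<one>" using ex_left_inverse[OF r assms(3)] by blast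
  then have "\<one> \<in> H" using D(5)[of s r] assms(2) by simp
  then have "x \<in> H" if "x \<in> carrier R" for x using D(5)[of x \<one>] that by simp
  then show ?thesis using D(1) by auto
qed

lemma simple_top_hom:
  "left_module_hom R (regular_module R) (simple_top R) (\<lambda>x. J +> x)"
  "(\<lambda>x. J +> x) ` carrier R = carrier (simple_top R)"
  "a_kernel (regular_module R) (simple_top R) (\<lambda>x. J +> x) = J"
proof -
  have [simp]: "(+>\<^bsub>regular_module R\<^esub>) = (+>)"
    by (intro ext) (simp add: a_r_coset_def')
  show "left_module_hom R (regular_module R) (simple_top R) (\<lambda>x. J +> x)"
    "(\<lambda>x. J +> x) ` carrier R = carrier (simple_top R)"
    "a_kernel (regular_module R) (simple_top R) (\<lambda>x. J +> x) = J"
    using A.module_quot_hom[OF submodule_radical] by (simp_all add: simple_top_def)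
qed

text \<open>The preimage of a submodule is a left ideal, which either lies in J or contains a left
  invertible element and hence everything.\<close>

lemma length_simple_top: "module_length R (simple_top R) = 1"
proof -
  interpret p: left_module_hom R "regular_module R" "simple_top R" "\<lambda>x. J +> x"
    by (rule simple_top_hom(1))
  have surj: "(\<lambda>x. J +> x) ` carrier (regular_module R) = carrier (simple_top R)"
    using simple_top_hom(2) by simp
  show ?thesis
  proof (rule p.N.length_eq_one)
    have "\<one> \<notin> a_kernel (regular_module R) (simple_top R) (\<lambda>x. J +> x)"
      using one_notin_radical simple_top_hom(3) by simp
    then have "J +> \<one> \<noteq> \<zero>\<^bsub>simple_top R\<^esub>" by (simp add: p.kernel_eq)
    moreover have "J +> \<one> \<in> carrier (simple_top R)" using p.hom_closed[of \<one>] by simp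
    ultimately show "carrier (simple_top R) \<noteq> {\<zero>\<^bsub>simple_top R\<^esub>}" by auto
  next
    fix C assume C: "submodule C R (simple_top R)"
    let ?H = "{x \<in> carrier (regular_module R). J +> x \<in> C}"
    have H: "submodule ?H R (regular_module R)" by (rule p.submodule_preimage[OF C])
    show "C = {\<zero>\<^bsub>simple_top R\<^esub>} \<or> C = carrier (simple_top R)"
    proof (cases "?H \<subseteq> J")
      case True
      have "c = \<zero>\<^bsub>simple_top R\<^esub>" if c: "c \<in> C" for c
      proof -
        have "c \<in> carrier (simple_top R)" using c p.N.submoduleD(1)[OF C] by auto
        then obtain x where x: "x \<in> carrier R" "c = J +> x"
          using simple_top_hom(2) by (metis imageE)
        then have "x \<in> J" using True c by auto
        then have "x \<in> a_kernel (regular_module R) (simple_top R) (\<lambda>x. J +> x)"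
          using simple_top_hom(3) by simp
        then show ?thesis using x(2) by (simp add: p.kernel_eq)
      qed
      then have "C = {\<zero>\<^bsub>simple_top R\<^esub>}" using p.N.submoduleD(2)[OF C] by blast
      then show ?thesis ..
    next
      case False
      then obtain r where "r \<in> ?H" "r \<notin> J" by blast
      then have "?H = carrier R" by (rule submodule_eq_carrier[OF H])
      then have "J +> x \<in> C" if "x \<in> carrier R" for x using that by blast
      then have "carrier (simple_top R) \<subseteq> C"
        unfolding simple_top_hom(2)[symmetric] by (rule image_subsetI)
      then show ?thesis using p.N.submoduleD(1)[OF C] by auto
    qed
  qed
qed

lemma length_radical:
  "module_length R ((regular_module R)\<lparr>carrier := J\<rparr>) = enat (e + a)"
proof -
  interpret RJ: plain_left_module R "(regular_module R)\<lparr>carrier := J\<rparr>"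
    by (intro plain_left_module.intro A.left_module_submodule submodule_radical)
  have "submodule J2 R ((regular_module R)\<lparr>carrier := J\<rparr>)"
    by (simp add: A.submodule_restrict_iff[OF submodule_radical] submodule_radical_square
        radical_square_subset)
  from RJ.length_quot[OF this] show ?thesis
    by (simp add: length_radical_quot length_radical_square add.commute)
qed

lemma length_regular: "module_length R (regular_module R) = enat (1 + e + a)"
  using A.length_quot[OF submodule_radical] length_radical length_simple_top
  by (simp add: simple_top_def one_enat_def)

lemma length_free:
  assumes "finite I"
  shows "module_length R (free_module R I) = enat (card I * (1 + e + a))"
  using length_vectors[OF assms submodule_regular_carrier, of "1 + e + a"] length_regular
  by (simp add: free_module_def regular_module_def)

lemma fin_length_free: "finite I \<Longrightarrow> fin_length_module R (free_module R I)"
  using plain_left_module_free[of I] length_free[of I]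
  by (simp add: fin_length_module_def plain_left_module_def)

lemma length_vectors_radical:
  "finite I \<Longrightarrow> module_length R ((fun_module R)\<lparr>carrier := vectors R I J\<rparr>) = enat (card I * (e + a))"
  by (rule length_vectors[OF _ submodule_radical length_radical])

lemma length_vectors_radical_square:
  "finite I \<Longrightarrow> module_length R ((fun_module R)\<lparr>carrier := vectors R I J2\<rparr>) = enat (card I * a)"
  by (rule length_vectors[OF _ submodule_radical_square length_radical_square])

lemma vectors_carrier:
  "x \<in> vectors R I (carrier R) \<Longrightarrow> x i \<in> carrier R"
  by (cases "i \<in> I") (auto simp: vectors_def)

text \<open>The inclusion from left to right needs J to be a right ideal, since in
  \<open>j \<otimes> x i\<close> the arbitrary ring element stands on the right.\<close>

lemma rad_mult_free:
  assumes "finite I"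
  shows "rad_mult R (free_module R I) = vectors R I J"
proof -
  interpret F: plain_left_module R "free_module R I" by (rule plain_left_module_free)
  show ?thesis
  proof
    show "rad_mult R (free_module R I) \<subseteq> vectors R I J"
    proof (rule F.rad_mult_least)
      show "submodule (vectors R I J) R (free_module R I)"
        by (rule submodule_vectors_free[OF submodule_radical]) simp
      fix j x assume j: "j \<in> J" and x: "x \<in> carrier (free_module R I)"
      have "if i \<in> I then j \<otimes> x i \<in> J else j \<otimes> x i = \<zero>" for i
        using j x vectors_carrier[of x I i] J.I_r_closed J.Icarr by (auto simp: vectors_def)
      then show "j \<odot>\<^bsub>free_module R I\<^esub> x \<in> vectors R I J" by (simp add: vectors_def)
    qed
    show "vectors R I J \<subseteq> rad_mult R (free_module R I)"
    proof (rule vectors_span)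
      note D = F.submoduleD[OF F.submodule_rad_mult]
      show "(\<lambda>i. \<zero>) \<in> rad_mult R (free_module R I)" using D(2) by simp
      show "(\<lambda>i. x i \<oplus> y i) \<in> rad_mult R (free_module R I)"
        if "x \<in> rad_mult R (free_module R I)" "y \<in> rad_mult R (free_module R I)" for x y
        using D(3)[OF that] by simp
      show "(\<lambda>k. v \<otimes> unit_vec R i k) \<in> rad_mult R (free_module R I)"
        if "i \<in> I" "v \<in> J" for i v
        using F.rad_mult_incl[OF that(2), of "unit_vec R i"] unit_vec_in_vectors[OF that(1)] by simp
    qed (use assms radical_subset in auto)
  qed
qed

text \<open>Gaussian elimination with pivot \<open>x i\<close>. In the applications \<open>x\<close>
  maps to zero in the covered module, so adding a multiple of it does not change the image of
  \<open>z\<close> there.\<close>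

lemma clear_coordinate:
  assumes x: "x \<in> vectors R I (carrier R)" and i: "i \<in> I" "x i \<notin> J"
    and z: "z \<in> vectors R I (carrier R)"
  obtains r where "r \<in> carrier R" "(\<lambda>k. z k \<oplus> r \<otimes> x k) \<in> vectors R (I - {i}) (carrier R)"
proof -
  obtain s where s: "s \<in> carrier R" "s \<otimes> x i = \<one>"
    using ex_left_inverse[OF vectors_carrier[OF x] i(2)] by blast
  note c = vectors_carrier[OF x] vectors_carrier[OF z]
  let ?r = "\<ominus> (z i \<otimes> s)"
  have r: "?r \<in> carrier R" using c s by simp
  have "?r \<otimes> x i = \<ominus> z i" using c s by (simp add: l_minus m_assoc)
  then have "z i \<oplus> ?r \<otimes> x i = \<zero>" using c by (simp add: r_neg)
  then have "if k \<in> I - {i} then z k \<oplus> ?r \<otimes> x k \<in> carrier R else z k \<oplus> ?r \<otimes> x k = \<zero>" for k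
    using x z c r by (auto simp: vectors_def)
  then have "(\<lambda>k. z k \<oplus> ?r \<otimes> x k) \<in> vectors R (I - {i}) (carrier R)"
    unfolding vectors_def by blast
  with r that show ?thesis by blast
qed

lemma vectors_radicalI:
  assumes "x \<in> vectors R I (carrier R)" "\<And>i. i \<in> I \<Longrightarrow> x i \<in> J"
  shows "x \<in> vectors R I J"
  using assms by (auto simp: vectors_def)

text \<open>The number of basis vectors is taken as small as possible. A kernel vector with a
  coordinate outside J would serve as a pivot eliminating that basis vector, and the remaining ones
  would still generate \<open>M\<close>.\<close>

lemma minimal_free_cover:
  fixes M :: "('a, 'm) module"
  assumes M: "plain_left_module R M" and fin: "module_length R M < \<infinity>"
  obtains I h where "finite I" "left_module_hom R (free_module R I) M h"
    "h ` vectors R I (carrier R) = carrier M" "a_kernel (free_module R I) M h \<subseteq> vectors R I J"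
proof -
  let ?P = "\<lambda>n. \<exists>I h. finite I \<and> card I = n \<and> left_module_hom R (free_module R I) M h \<and>
    h ` vectors R I (carrier R) = carrier M"
  have "\<exists>n. ?P n" using free_cover_exists[OF M fin] by metis
  from LeastI_ex[OF this] obtain I h where I: "finite I" "card I = (LEAST n. ?P n)"
    and h: "left_module_hom R (free_module R I) M h" "h ` vectors R I (carrier R) = carrier M"
    by blast
  interpret h: left_module_hom R "free_module R I" M h by fact
  have "x i \<in> J" if x: "x \<in> a_kernel (free_module R I) M h" and i: "i \<in> I" for x i
  proof (rule ccontr)
    assume xi: "x i \<notin> J"
    have xc: "x \<in> vectors R I (carrier R)" "h x = \<zero>\<^bsub>M\<^esub>" using x by (auto simp: h.kernel_eq)
    have sub: "submodule (vectors R (I - {i}) (carrier R)) R (free_module R I)"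
      by (rule submodule_vectors_free[OF submodule_regular_carrier]) blast
    have "left_module_hom R ((free_module R I)\<lparr>carrier := vectors R (I - {i}) (carrier R)\<rparr>)
        (M\<lparr>carrier := carrier M\<rparr>) h"
      using h.M.submoduleD(1)[OF sub] by (intro h.restrict_hom sub h.N.submodule_carrier) auto
    then have "left_module_hom R (free_module R (I - {i})) M h"
      by (simp add: free_module_def)
    moreover have "h ` vectors R (I - {i}) (carrier R) = carrier M"
    proof
      show "h ` vectors R (I - {i}) (carrier R) \<subseteq> carrier M"
        using h.M.submoduleD(1)[OF sub] by auto
      show "carrier M \<subseteq> h ` vectors R (I - {i}) (carrier R)"
      proof
        fix y assume "y \<in> carrier M"
        then obtain z where z: "z \<in> vectors R I (carrier R)" "y = h z" using h(2) by (metis imageE)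
        obtain r where r: "r \<in> carrier R"
          "(\<lambda>k. z k \<oplus> r \<otimes> x k) \<in> vectors R (I - {i}) (carrier R)"
          using clear_coordinate[OF xc(1) i xi z(1)] .
        have "h (z \<oplus>\<^bsub>free_module R I\<^esub> r \<odot>\<^bsub>free_module R I\<^esub> x) = h z \<oplus>\<^bsub>M\<^esub> r \<odot>\<^bsub>M\<^esub> h x"
          using h.hom_add[of z "r \<odot>\<^bsub>free_module R I\<^esub> x"] h.hom_smult[of r x]
            h.M.smult_closed[of r x] r z xc by simp
        then have "h (\<lambda>k. z k \<oplus> r \<otimes> x k) = y"
          using xc z r h.hom_closed[of z] by simp
        with r(2) show "y \<in> h ` vectors R (I - {i}) (carrier R)" by blast
      qed
    qed
    ultimately have "?P (card (I - {i}))" using I by blast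
    then have "(LEAST n. ?P n) \<le> card (I - {i})" by (rule Least_le)
    then show False using I i by (metis card_Diff1_less not_less)
  qed
  then have "a_kernel (free_module R I) M h \<subseteq> vectors R I J"
    by (auto intro!: vectors_radicalI simp: h.kernel_eq)
  with I h that show ?thesis by blast
qed

text \<open>Nakayama's lemma, by substituting the hypothesis into itself until the cube of the radical
  appears.\<close>

lemma nakayama_free:
  assumes "finite I" and U: "submodule U R (free_module R I)"
    and gen: "\<And>i. i \<in> I \<Longrightarrow> \<exists>u\<in>U. \<exists>b\<in>vectors R I J. unit_vec R i = (\<lambda>k. u k \<oplus> b k)"
  shows "U = carrier (free_module R I)"
proof -
  interpret F: plain_left_module R "free_module R I" by (rule plain_left_module_free)
  note D = F.submoduleD[OF U]
  have Uc: "u k \<in> carrier R" if "u \<in> U" for u k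
    using vectors_carrier[of u I k] D(1) that by auto
  have Jc: "b k \<in> J" if "b \<in> vectors R I J" for b k
    using that J.zero_closed by (cases "k \<in> I") (auto simp: vectors_def)
  \<comment> \<open>The hypothesis multiplied by \<open>v\<close>. The error
    \<open>v \<otimes> b k\<close> lies one power of the radical deeper than \<open>v\<close>, which
    is why coefficients from J^2, J and R are treated in this order, each case absorbing the error
    by the one before and the first by J^3 = 0.\<close>
  have step: "\<exists>u\<in>U. \<exists>b\<in>vectors R I J. (\<lambda>k. v \<otimes> unit_vec R i k) = (\<lambda>k. u k \<oplus> v \<otimes> b k)"
    if i: "i \<in> I" and v: "v \<in> carrier R" for i v
  proof -
    obtain u b where ub: "u \<in> U" "b \<in> vectors R I J" "unit_vec R i = (\<lambda>k. u k \<oplus> b k)"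
      using gen[OF i] by blast
    have "(\<lambda>k. v \<otimes> unit_vec R i k) = (\<lambda>k. v \<otimes> u k \<oplus> v \<otimes> b k)"
      using ub v Uc Jc J.Icarr by (auto simp: r_distr)
    moreover have "(\<lambda>k. v \<otimes> u k) \<in> U" using D(5)[OF v ub(1)] by simp
    ultimately show ?thesis
      by (intro bexI[of _ "\<lambda>k. v \<otimes> u k"] bexI[of _ b]) (use ub(2) in auto)
  qed
  have sq: "vectors R I J2 \<subseteq> U"
  proof (rule vectors_span)
    fix i v assume i: "i \<in> I" and v: "v \<in> J2"
    obtain u b where ub: "u \<in> U" "b \<in> vectors R I J" "(\<lambda>k. v \<otimes> unit_vec R i k) = (\<lambda>k. u k \<oplus> v \<otimes> b k)"
      using step[OF i J2.Icarr[OF v]] by blast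
    have "(\<lambda>k. u k \<oplus> v \<otimes> b k) = u"
      using radical_cube[OF v] Jc[OF ub(2)] Uc[OF ub(1)] by auto
    with ub show "(\<lambda>k. v \<otimes> unit_vec R i k) \<in> U" by simp
  qed (use assms D(2,3) J2.Icarr in auto)
  have rad: "vectors R I J \<subseteq> U"
  proof (rule vectors_span)
    fix i v assume i: "i \<in> I" and v: "v \<in> J"
    obtain u b where ub: "u \<in> U" "b \<in> vectors R I J" "(\<lambda>k. v \<otimes> unit_vec R i k) = (\<lambda>k. u k \<oplus> v \<otimes> b k)"
      using step[OF i J.Icarr[OF v]] by blast
    have "if k \<in> I then v \<otimes> b k \<in> J2 else v \<otimes> b k = \<zero>" for k
      using ub(2) v J.Icarr by (auto simp: vectors_def intro: ideal_prod.prod)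
    then have "(\<lambda>k. v \<otimes> b k) \<in> U" using sq by (auto simp: vectors_def)
    then show "(\<lambda>k. v \<otimes> unit_vec R i k) \<in> U" using D(3)[OF ub(1)] ub(3) by simp
  qed (use assms D(2,3) J.Icarr in auto)
  have "vectors R I (carrier R) \<subseteq> U"
  proof (rule vectors_span)
    fix i v assume i: "i \<in> I" and v: "v \<in> carrier R"
    obtain u b where ub: "u \<in> U" "b \<in> vectors R I J" "(\<lambda>k. v \<otimes> unit_vec R i k) = (\<lambda>k. u k \<oplus> v \<otimes> b k)"
      using step[OF i v] by blast
    have "(\<lambda>k. v \<otimes> b k) \<in> U" using D(5)[OF v, of b] rad ub(2) by auto
    then show "(\<lambda>k. v \<otimes> unit_vec R i k) \<in> U" using D(3)[OF ub(1)] ub(3) by simp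
  qed (use assms D(2,3) in auto)
  with D(1) show ?thesis by simp
qed

lemma projective_free:
  assumes "finite I"
  shows "projective R (free_module R I)"
  unfolding projective_def
proof (intro conjI fin_length_free assms allI impI)
  fix M N :: "'a umodule" and g h
  assume *: "fin_length_module R M \<and> fin_length_module R N \<and> g \<in> module_hom R M N \<and>
    g ` carrier M = carrier N \<and> h \<in> module_hom R (free_module R I) N"
  interpret M: plain_left_module R M
    using * by (intro plain_left_module.intro) (simp add: fin_length_module_def)
  interpret N: plain_left_module R N
    using * by (intro plain_left_module.intro) (simp add: fin_length_module_def)
  interpret g: left_module_hom R M N g
    using * by unfold_locales simp
  interpret h: left_module_hom R "free_module R I" N h
    using * plain_left_module_free
    by (intro left_module_hom.intro left_module_hom_axioms.intro N.plain_left_module_axioms) auto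
  have "\<exists>m\<in>carrier M. g m = h (unit_vec R i)" if "i \<in> I" for i
  proof -
    have "h (unit_vec R i) \<in> g ` carrier M"
      using * h.hom_closed unit_vec_in_vectors[OF that] by simp
    then show ?thesis by (metis imageE)
  qed
  then obtain m where m: "\<And>i. i \<in> I \<Longrightarrow> m i \<in> carrier M" "\<And>i. i \<in> I \<Longrightarrow> g (m i) = h (unit_vec R i)"
    by metis
  obtain h' where h': "left_module_hom R (free_module R I) M h'" "\<forall>i\<in>I. h' (unit_vec R i) = m i"
    using free_hom_exists[OF assms M.plain_left_module_axioms, of m] m(1) by blast
  have "g (h' x) = h x" if "x \<in> carrier (free_module R I)" for x
    using free_hom_eqI[OF left_module_hom_comp[OF h'(1) g.left_module_hom_axioms]
        h.left_module_hom_axioms assms, of x] that h'(2) m(2) by simp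
  with h'(1) show "\<exists>h'\<in>module_hom R (free_module R I) M. \<forall>p\<in>carrier (free_module R I). g (h' p) = h p"
    by (auto dest: left_module_hom.hom)
qed

text \<open>The choice in \<open>Omega\<close> needs a witness, and a minimal free cover is one: if
  U and the kernel together generate F, then U + JF = F, and Nakayama's lemma gives U = F.\<close>

lemma projective_cover_exists:
  fixes M :: "('a, 'm) module"
  assumes "fin_length_module R M"
  shows "\<exists>P f. projective_cover R P M f"
proof -
  have M: "plain_left_module R M" "module_length R M < \<infinity>"
    using assms by (auto simp: fin_length_module_def plain_left_module_def)
  obtain I h where I: "finite I" and hh: "left_module_hom R (free_module R I) M h"
    and surj: "h ` vectors R I (carrier R) = carrier M"
    and ker: "a_kernel (free_module R I) M h \<subseteq> vectors R I J"
    using minimal_free_cover[OF M] .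
  interpret h: left_module_hom R "free_module R I" M h by fact
  have "U = carrier (free_module R I)"
    if U: "submodule U R (free_module R I)"
      and sum: "U <+>\<^bsub>free_module R I\<^esub> a_kernel (free_module R I) M h = carrier (free_module R I)" for U
  proof (rule nakayama_free[OF I U])
    fix i assume "i \<in> I"
    then have "unit_vec R i \<in> U <+>\<^bsub>free_module R I\<^esub> a_kernel (free_module R I) M h"
      using sum unit_vec_in_vectors by simp
    then obtain u b where "u \<in> U" "b \<in> a_kernel (free_module R I) M h"
      "unit_vec R i = (\<lambda>k. u k \<oplus> b k)" unfolding set_add_def' by auto
    with ker show "\<exists>u\<in>U. \<exists>b\<in>vectors R I J. unit_vec R i = (\<lambda>k. u k \<oplus> b k)" by blast
  qed
  then have "projective_cover R (free_module R I) M h"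
    using projective_free[OF I] h.hom surj by (simp add: projective_cover_def)
  then show ?thesis by blast
qed

text \<open>Lifting the identity of \<open>P\<close> along a minimal free cover \<open>g\<close>
  gives a splitting \<open>s\<close>. Each unit vector differs from its image under \<open>s\<close>
  after \<open>g\<close> by an element of the kernel, hence of JF, so \<open>s\<close> is onto by
  Nakayama's lemma; a map with a surjective right inverse is injective. The lifting property applies
  because free modules have the carrier type of \<open>umodule\<close>.\<close>

lemma projective_imp_free:
  assumes "projective R P"
  obtains I g where "finite I" "left_module_hom R (free_module R I) P g"
    "g ` vectors R I (carrier R) = carrier P" "inj_on g (vectors R I (carrier R))"
proof -
  have P: "plain_left_module R P" "module_length R P < \<infinity>" "fin_length_module R P"
    using assms by (auto simp: projective_def fin_length_module_def plain_left_module_def)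
  obtain I g where I: "finite I" and gg: "left_module_hom R (free_module R I) P g"
    and surj: "g ` vectors R I (carrier R) = carrier P"
    and ker: "a_kernel (free_module R I) P g \<subseteq> vectors R I J"
    using minimal_free_cover[OF P(1,2)] .
  interpret g: left_module_hom R "free_module R I" P g by fact
  have "(\<lambda>x. x) \<in> module_hom R P P" by (auto simp: module_hom_def)
  then obtain s where s: "s \<in> module_hom R P (free_module R I)" "\<And>p. p \<in> carrier P \<Longrightarrow> g (s p) = p"
    using assms fin_length_free[OF I] P(3) g.hom surj unfolding projective_def
    by (metis free_module_simps(2))
  interpret s: left_module_hom R P "free_module R I" s
    by (intro left_module_hom.intro left_module_hom_axioms.intro s(1) P(1)
        g.M.plain_left_module_axioms)
  have im: "s ` carrier P = carrier (free_module R I)"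
  proof (rule nakayama_free[OF I s.submodule_image[OF g.N.submodule_carrier]])
    fix i assume i: "i \<in> I"
    let ?F = "free_module R I"
    let ?e = "unit_vec R i"
    have e: "?e \<in> carrier ?F" using unit_vec_in_vectors[OF i] by simp
    have ge: "g ?e \<in> carrier P" using g.hom_closed[OF e] .
    have sc: "s (g ?e) \<in> carrier ?F" using s.hom_closed[OF ge] .
    have "?e \<ominus>\<^bsub>?F\<^esub> s (g ?e) \<in> vectors R I J"
      using g.diff_in_kernel[OF e sc] s(2)[OF ge] ker by auto
    moreover have "?e = s (g ?e) \<oplus>\<^bsub>?F\<^esub> (?e \<ominus>\<^bsub>?F\<^esub> s (g ?e))"
      using e sc g.M.M.a_lcomm[of "s (g ?e)" ?e] g.M.M.r_neg[of "s (g ?e)"]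
        g.M.M.r_zero[OF e] g.M.M.a_inv_closed[OF sc] unfolding g.M.M.minus_eq by metis
    ultimately show "\<exists>u\<in>s ` carrier P. \<exists>b\<in>vectors R I J. ?e = (\<lambda>k. u k \<oplus> b k)"
      using ge by auto
  qed
  have "x = y" if "x \<in> vectors R I (carrier R)" "y \<in> vectors R I (carrier R)" "g x = g y" for x y
  proof -
    have "x \<in> s ` carrier P" "y \<in> s ` carrier P" using that im by simp_all
    then obtain p q where "p \<in> carrier P" "x = s p" "q \<in> carrier P" "y = s q" by blast
    then show ?thesis using s(2)[of p] s(2)[of q] that(3) by simp
  qed
  then have "inj_on g (vectors R I (carrier R))" by (rule inj_onI)
  with I gg surj that show ?thesis by blast
qed

end


section \<open>Syzygies over a short local ring\<close>

context short_local_ring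
begin

lemma cover_presentation:
  fixes M :: "('a, 'm) module"
  assumes pc: "projective_cover R P M f" and M: "plain_left_module R M"
  obtains I g where "finite I" "left_module_hom R (free_module R I) P g"
    "g ` vectors R I (carrier R) = carrier P" "inj_on g (vectors R I (carrier R))"
    "a_kernel (free_module R I) M (\<lambda>x. f (g x)) \<subseteq> vectors R I J"
proof -
  have pP: "projective R P" and f: "f \<in> module_hom R P M"
    and superfluous: "\<And>U. submodule U R P \<Longrightarrow> U <+>\<^bsub>P\<^esub> a_kernel P M f = carrier P \<Longrightarrow> U = carrier P"
    using pc by (auto simp: projective_cover_def)
  obtain I g where I: "finite I" and gg: "left_module_hom R (free_module R I) P g"
    and surj: "g ` vectors R I (carrier R) = carrier P"
    and inj: "inj_on g (vectors R I (carrier R))"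
    using projective_imp_free[OF pP] .
  interpret g: left_module_hom R "free_module R I" P g by fact
  interpret f: left_module_hom R P M f
    by (intro left_module_hom.intro left_module_hom_axioms.intro g.N.plain_left_module_axioms M f)
  have "x i \<in> J" if x: "x \<in> vectors R I (carrier R)" "f (g x) = \<zero>\<^bsub>M\<^esub>" and i: "i \<in> I" for x i
  proof (rule ccontr)
    assume xi: "x i \<notin> J"
    let ?U = "g ` vectors R (I - {i}) (carrier R)"
    have sub: "submodule (vectors R (I - {i}) (carrier R)) R (free_module R I)"
      by (rule submodule_vectors_free[OF submodule_regular_carrier]) blast
    have U: "submodule ?U R P" by (rule g.submodule_image[OF sub])
    have ker: "g x \<in> a_kernel P M f" using x g.hom_closed[of x] by (simp add: f.kernel_eq)
    note K = g.N.submoduleD[OF f.submodule_kernel]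
    have "?U <+>\<^bsub>P\<^esub> a_kernel P M f = carrier P"
    proof
      show "?U <+>\<^bsub>P\<^esub> a_kernel P M f \<subseteq> carrier P"
        using g.N.submoduleD(1)[OF U] K(1) by (rule g.N.M.setadd_subset_G)
      show "carrier P \<subseteq> ?U <+>\<^bsub>P\<^esub> a_kernel P M f"
      proof
        fix p assume "p \<in> carrier P"
        then obtain z where z: "z \<in> vectors R I (carrier R)" "p = g z" using surj by (metis imageE)
        obtain r where r: "r \<in> carrier R"
          "(\<lambda>k. z k \<oplus> r \<otimes> x k) \<in> vectors R (I - {i}) (carrier R)"
          using clear_coordinate[OF x(1) i xi z(1)] .
        have gx: "g x \<in> carrier P" "r \<odot>\<^bsub>P\<^esub> g x \<in> carrier P" "p \<in> carrier P"
          using r(1) x z g.hom_closed[of x] g.hom_closed[of z] by simp_all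
        have "g (z \<oplus>\<^bsub>free_module R I\<^esub> r \<odot>\<^bsub>free_module R I\<^esub> x) = p \<oplus>\<^bsub>P\<^esub> r \<odot>\<^bsub>P\<^esub> g x"
          using g.hom_add[of z "r \<odot>\<^bsub>free_module R I\<^esub> x"] g.hom_smult[of r x]
            g.M.smult_closed[of r x] r z x by simp
        then have "p \<oplus>\<^bsub>P\<^esub> r \<odot>\<^bsub>P\<^esub> g x \<in> ?U" using imageI[OF r(2), of g] by simp
        moreover have "\<ominus>\<^bsub>P\<^esub> (r \<odot>\<^bsub>P\<^esub> g x) \<in> a_kernel P M f"
          using K(4,5) r(1) ker by blast
        moreover have "p = (p \<oplus>\<^bsub>P\<^esub> r \<odot>\<^bsub>P\<^esub> g x) \<oplus>\<^bsub>P\<^esub> \<ominus>\<^bsub>P\<^esub> (r \<odot>\<^bsub>P\<^esub> g x)"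
          using gx by (simp add: g.N.M.a_assoc g.N.M.r_neg)
        ultimately show "p \<in> ?U <+>\<^bsub>P\<^esub> a_kernel P M f"
          unfolding set_add_def' by blast
      qed
    qed
    then have "?U = carrier P" by (rule superfluous[OF U])
    then have "g (unit_vec R i) \<in> ?U"
      using g.hom_closed[of "unit_vec R i"] unit_vec_in_vectors[OF i] by simp
    then obtain y where y: "y \<in> vectors R (I - {i}) (carrier R)" "g (unit_vec R i) = g y" by blast
    then have "unit_vec R i = y"
      using inj_onD[OF inj y(2) unit_vec_in_vectors[OF i]] g.M.submoduleD(1)[OF sub] by auto
    \<comment> \<open>Coordinate \<open>i\<close> of the unit vector is 1 and that of
      \<open>y\<close> is 0, so 1 would lie in J.\<close>
    then have "unit_vec R i i = \<zero>" using y(1) by (simp add: vectors_def)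
    then show False using one_notin_radical J.zero_closed by (simp add: unit_vec_def)
  qed
  then have "a_kernel (free_module R I) M (\<lambda>x. f (g x)) \<subseteq> vectors R I J"
    by (auto intro!: vectors_radicalI simp: a_kernel_def')
  with I gg surj inj that show ?thesis by blast
qed

text \<open>The kernel in \<open>P\<close> is pulled back along \<open>g\<close> to a submodule
  \<open>?K\<close> of a free module, where coordinates are available to estimate its
  radical.\<close>

lemma syzygy_bounds:
  fixes M :: "('a, 'm) module"
  assumes pc: "projective_cover R P M f" and finM: "fin_length_module R M"
  defines "N \<equiv> P\<lparr>carrier := a_kernel P M f\<rparr>"
  shows "fin_length_module R N"
    and "module_length R (N\<lparr>carrier := rad_mult R N\<rparr>) \<le> enat (a * top_length R M)"
    and "enat (e * top_length R M) \<le>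
      enat (top_length R N) + module_length R (M\<lparr>carrier := rad_mult R M\<rparr>)"
proof -
  have M: "plain_left_module R M" "module_length R M < \<infinity>"
    using finM by (auto simp: fin_length_module_def plain_left_module_def)
  have f: "f \<in> module_hom R P M" "f ` carrier P = carrier M"
    using pc by (auto simp: projective_cover_def)
  obtain I g where I: "finite I" and gg: "left_module_hom R (free_module R I) P g"
    and surj: "g ` vectors R I (carrier R) = carrier P"
    and inj: "inj_on g (vectors R I (carrier R))"
    and ker: "a_kernel (free_module R I) M (\<lambda>x. f (g x)) \<subseteq> vectors R I J"
    using cover_presentation[OF pc M(1)] .
  let ?F = "free_module R I"
  let ?K = "a_kernel ?F M (\<lambda>x. f (g x))"
  let ?c = "card I"
  interpret g: left_module_hom R ?F P g by fact
  interpret f: left_module_hom R P M f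
    by (intro left_module_hom.intro left_module_hom_axioms.intro g.N.plain_left_module_axioms
        M(1) f(1))
  interpret p: left_module_hom R ?F M "\<lambda>x. f (g x)"
    by (rule left_module_hom_comp[OF gg f.left_module_hom_axioms])
  have psurj: "(\<lambda>x. f (g x)) ` carrier ?F = carrier M"
    using surj f(2) by (metis free_module_simps(2) image_image)
  have lenF: "module_length R (?F\<lparr>carrier := ?K\<rparr>) + module_length R M = enat (?c * (1 + e + a))"
    using p.length_eq_kernel_add_image[OF psurj] length_free[OF I] by simp
  have gK: "g ` ?K = a_kernel P M f"
  proof (intro equalityI subsetI)
    fix y assume "y \<in> a_kernel P M f"
    then have y: "y \<in> carrier P" "f y = \<zero>\<^bsub>M\<^esub>" by (auto simp: f.kernel_eq)
    then obtain x where "x \<in> vectors R I (carrier R)" "y = g x" using surj by (metis imageE)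
    with y show "y \<in> g ` ?K" by (auto simp: p.kernel_eq)
  next
    fix y assume "y \<in> g ` ?K"
    then show "y \<in> a_kernel P M f" using g.hom_closed by (auto simp: p.kernel_eq f.kernel_eq)
  qed
  interpret k: left_module_hom R "?F\<lparr>carrier := ?K\<rparr>" N g
    unfolding N_def
    by (rule g.restrict_hom[OF p.submodule_kernel f.submodule_kernel]) (simp add: gK)
  have ksurj: "g ` carrier (?F\<lparr>carrier := ?K\<rparr>) = carrier N" by (simp add: N_def gK)
  have "inj_on g (carrier (?F\<lparr>carrier := ?K\<rparr>))"
    using inj g.M.submoduleD(1)[OF p.submodule_kernel] by (auto intro: inj_on_subset)
  then have lenN: "module_length R (?F\<lparr>carrier := ?K\<rparr>) = module_length R N"
    by (rule k.length_eq_if_bij[OF _ ksurj])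
  have lenNM: "module_length R N + module_length R M = enat (?c * (1 + e + a))"
    using lenF lenN by simp
  then have finN: "module_length R N < \<infinity>"
    by (cases "module_length R N") auto
  then show "fin_length_module R N"
    unfolding fin_length_module_def using k.N.left_module_axioms by blast

  \<comment> \<open>The map from F to M/JM has kernel exactly JF: a vector sent into JM differs from
    one in JF by an element of \<open>?K\<close>, which lies in JF. So M/JM has length c (1 + e + a)
    - c (e + a) = c.\<close>
  have top: "top_length R M = ?c"
  proof -
    let ?q = "\<lambda>m. rad_mult R M +>\<^bsub>M\<^esub> m"
    interpret q: left_module_hom R M "module_quot M (rad_mult R M)" ?q
      by (rule f.N.module_quot_hom(1)[OF f.N.submodule_rad_mult])
    interpret r: left_module_hom R ?F "module_quot M (rad_mult R M)" "\<lambda>x. ?q (f (g x))"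
      by (rule left_module_hom_comp[OF p.left_module_hom_axioms q.left_module_hom_axioms])
    have "(\<lambda>x. ?q (f (g x))) ` carrier ?F = ?q ` carrier M"
      using psurj by (metis image_image)
    also have "\<dots> = carrier (module_quot M (rad_mult R M))"
      by (rule f.N.module_quot_hom(2)[OF f.N.submodule_rad_mult])
    finally have rsurj: "(\<lambda>x. ?q (f (g x))) ` carrier ?F = carrier (module_quot M (rad_mult R M))" .
    have sub: "submodule (vectors R I J) R ?F"
      by (rule submodule_vectors_free[OF submodule_radical order_refl])
    note D = g.M.submoduleD[OF sub]
    have radM: "rad_mult R M = (\<lambda>x. f (g x)) ` vectors R I J"
      using p.image_rad_mult[OF psurj] rad_mult_free[OF I] by simp
    have qiff: "?q m = \<zero>\<^bsub>module_quot M (rad_mult R M)\<^esub> \<longleftrightarrow> m \<in> rad_mult R M"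
      if "m \<in> carrier M" for m
      using f.N.module_quot_hom(3)[OF f.N.submodule_rad_mult] that q.kernel_eq by auto
    have "a_kernel ?F (module_quot M (rad_mult R M)) (\<lambda>x. ?q (f (g x))) = vectors R I J"
    proof (intro equalityI subsetI)
      fix x assume "x \<in> a_kernel ?F (module_quot M (rad_mult R M)) (\<lambda>x. ?q (f (g x)))"
      then have x: "x \<in> carrier ?F" "f (g x) \<in> rad_mult R M"
        using qiff p.hom_closed unfolding r.kernel_eq by auto
      then obtain y where y: "y \<in> vectors R I J" "f (g x) = f (g y)" using radM by auto
      have yc: "y \<in> carrier ?F" using y D(1) by auto
      have "x \<ominus>\<^bsub>?F\<^esub> y \<in> vectors R I J" using p.diff_in_kernel[OF x(1) yc y(2)] ker by blast
      then have "(x \<ominus>\<^bsub>?F\<^esub> y) \<oplus>\<^bsub>?F\<^esub> y \<in> vectors R I J" using D(3) y(1) by blast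
      moreover have "(x \<ominus>\<^bsub>?F\<^esub> y) \<oplus>\<^bsub>?F\<^esub> y = x"
        using x(1) yc by (metis g.M.M.a_assoc g.M.M.a_inv_closed g.M.M.l_neg g.M.M.minus_eq g.M.M.r_zero)
      ultimately show "x \<in> vectors R I J" by simp
    next
      fix x assume x: "x \<in> vectors R I J"
      then have "x \<in> carrier ?F" "f (g x) \<in> rad_mult R M" using D(1) radM by auto
      then show "x \<in> a_kernel ?F (module_quot M (rad_mult R M)) (\<lambda>x. ?q (f (g x)))"
        using qiff p.hom_closed unfolding r.kernel_eq by auto
    qed
    with r.length_eq_kernel_add_image[OF rsurj]
    have "enat (?c * (1 + e + a)) = enat (?c * (e + a)) + module_length R (module_quot M (rad_mult R M))"
      by (simp add: length_free[OF I] free_module_restrict length_vectors_radical[OF I])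
    then have "module_length R (module_quot M (rad_mult R M)) = enat ?c"
      by (cases "module_length R (module_quot M (rad_mult R M))") (auto simp: algebra_simps)
    then show ?thesis by (simp add: top_length_def)
  qed

  \<comment> \<open>\<open>?K\<close> lies in JF, so its products with J have coordinates in J^2.
    The intersection with \<open>?K\<close> appears because the radical of \<open>?K\<close> is the
    least among submodules of \<open>?K\<close>, not of F.\<close>
  have radK: "rad_mult R (?F\<lparr>carrier := ?K\<rparr>) \<subseteq> vectors R I J2"
  proof -
    have "rad_mult R (?F\<lparr>carrier := ?K\<rparr>) \<subseteq> vectors R I J2 \<inter> ?K"
    proof (rule k.M.rad_mult_least)
      show "submodule (vectors R I J2 \<inter> ?K) R (?F\<lparr>carrier := ?K\<rparr>)"
        using g.M.submodule_Int[OF submodule_vectors_free[OF submodule_radical_square order_refl]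
            p.submodule_kernel]
        by (simp add: g.M.submodule_restrict_iff[OF p.submodule_kernel])
      fix j x assume j: "j \<in> J" and x: "x \<in> carrier (?F\<lparr>carrier := ?K\<rparr>)"
      then have "x \<in> vectors R I J" "j \<in> carrier R" using ker J.Icarr by auto
      then have "if i \<in> I then j \<otimes> x i \<in> J2 else j \<otimes> x i = \<zero>" for i
        using j by (auto simp: vectors_def intro: ideal_prod.prod)
      moreover have "j \<odot>\<^bsub>?F\<lparr>carrier := ?K\<rparr>\<^esub> x \<in> ?K"
        using k.M.smult_closed[of j x] x \<open>j \<in> carrier R\<close> by simp
      ultimately show "j \<odot>\<^bsub>?F\<lparr>carrier := ?K\<rparr>\<^esub> x \<in> vectors R I J2 \<inter> ?K"
        by (simp add: vectors_def)
    qed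
    then show ?thesis by blast
  qed
  interpret kr: left_module_hom R "?F\<lparr>carrier := rad_mult R (?F\<lparr>carrier := ?K\<rparr>)\<rparr>"
      "N\<lparr>carrier := rad_mult R N\<rparr>" g
    using k.restrict_hom[OF k.M.submodule_rad_mult k.N.submodule_rad_mult] k.image_rad_mult[OF ksurj]
    by simp
  have subK: "submodule (rad_mult R (?F\<lparr>carrier := ?K\<rparr>)) R ?F"
    using k.M.submodule_rad_mult by (simp add: g.M.submodule_restrict_iff[OF p.submodule_kernel])
  have "module_length R (N\<lparr>carrier := rad_mult R N\<rparr>) \<le>
      module_length R (?F\<lparr>carrier := rad_mult R (?F\<lparr>carrier := ?K\<rparr>)\<rparr>)"
    by (rule kr.length_image_le) (simp add: k.image_rad_mult[OF ksurj])
  also have "\<dots> \<le> module_length R (?F\<lparr>carrier := vectors R I J2\<rparr>)"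
    by (rule g.M.length_submodule_mono[OF subK _ radK])
      (rule submodule_vectors_free[OF submodule_radical_square order_refl])
  also have "\<dots> = enat (a * top_length R M)"
    by (simp add: free_module_restrict length_vectors_radical_square[OF I] top mult.commute)
  finally show radN: "module_length R (N\<lparr>carrier := rad_mult R N\<rparr>) \<le> enat (a * top_length R M)" .

  note lenNM
  moreover note k.N.length_eq_rad_add_top[OF finN] f.N.length_eq_rad_add_top[OF M(2)]
  \<comment> \<open>With c = t(M), the count reads c + c e + c a = t(N) + |JN| + c + |JM|, and c a
    is at least |JN|.\<close>
  ultimately show "enat (e * top_length R M) \<le>
      enat (top_length R N) + module_length R (M\<lparr>carrier := rad_mult R M\<rparr>)"
    using radN top
    by (cases "module_length R (N\<lparr>carrier := rad_mult R N\<rparr>)";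
        cases "module_length R (M\<lparr>carrier := rad_mult R M\<rparr>)") (auto simp: algebra_simps)
qed

section \<open>Betti numbers of the simple module\<close>

definition rad_length :: "('a, 'm) module \<Rightarrow> nat" where
  "rad_length M = the_enat (module_length R (M\<lparr>carrier := rad_mult R M\<rparr>))"

lemma length_rad_mult:
  fixes M :: "('a, 'm) module"
  assumes "fin_length_module R M"
  shows "module_length R (M\<lparr>carrier := rad_mult R M\<rparr>) = enat (rad_length M)"
proof -
  interpret plain_left_module R M
    using assms by (intro plain_left_module.intro) (simp add: fin_length_module_def)
  have "module_length R (M\<lparr>carrier := rad_mult R M\<rparr>) < \<infinity>"
    using length_submodule_le[OF submodule_rad_mult] assms
    unfolding fin_length_module_def by (meson le_less_trans)
  then show ?thesis unfolding rad_length_def by (auto elim: less_infinityE)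
qed

text \<open>The bounds hold for every projective cover, hence for the chosen one.\<close>

lemma Omega_bounds:
  fixes M :: "('a, 'm) module"
  assumes "fin_length_module R M"
  shows "fin_length_module R (Omega R M)"
    and "rad_length (Omega R M) \<le> a * top_length R M"
    and "e * top_length R M \<le> top_length R (Omega R M) + rad_length M"
proof -
  have "\<exists>N P f. projective_cover R P M f \<and> N = P\<lparr>carrier := a_kernel P M f\<rparr>"
    using projective_cover_exists[OF assms] by blast
  then have "\<exists>P f. projective_cover R P M f \<and> Omega R M = P\<lparr>carrier := a_kernel P M f\<rparr>"
    unfolding Omega_def by (rule someI_ex)
  then obtain P f where pc: "projective_cover R P M f"
    and Omega: "Omega R M = P\<lparr>carrier := a_kernel P M f\<rparr>" by blast
  note b = syzygy_bounds[OF pc assms, folded Omega]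
  show "fin_length_module R (Omega R M)" by (rule b(1))
  then show "rad_length (Omega R M) \<le> a * top_length R M"
    using b(2) by (simp add: length_rad_mult)
  show "e * top_length R M \<le> top_length R (Omega R M) + rad_length M"
    using b(3) by (simp add: length_rad_mult[OF assms])
qed

text \<open>Initial data of the recurrence. J annihilates S because it is a right ideal, so nothing
  is subtracted in the bound for the first Betti number.\<close>

lemma simple_top_bounds:
  "fin_length_module R (simple_top R)" "rad_length (simple_top R) = 0" "top_length R (simple_top R) = 1"
proof -
  interpret p: left_module_hom R "regular_module R" "simple_top R" "\<lambda>x. J +> x"
    by (rule simple_top_hom(1))
  show fin: "fin_length_module R (simple_top R)"
    using p.N.left_module_axioms length_simple_top by (simp add: fin_length_module_def one_enat_def)
  have "rad_mult R (simple_top R) \<subseteq> {\<zero>\<^bsub>simple_top R\<^esub>}"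
  proof (rule p.N.rad_mult_least[OF p.N.submodule_zero])
    fix j c assume j: "j \<in> J" and "c \<in> carrier (simple_top R)"
    then obtain x where x: "x \<in> carrier R" "c = J +> x"
      using simple_top_hom(2) by (metis imageE)
    have "j \<otimes> x \<in> a_kernel (regular_module R) (simple_top R) (\<lambda>x. J +> x)"
      using J.I_r_closed[OF j x(1)] simple_top_hom(3) by simp
    then show "j \<odot>\<^bsub>simple_top R\<^esub> c \<in> {\<zero>\<^bsub>simple_top R\<^esub>}"
      using p.hom_smult[of j x] J.Icarr[OF j] x by (simp add: p.kernel_eq)
  qed
  then have "rad_mult R (simple_top R) = {\<zero>\<^bsub>simple_top R\<^esub>}"
    using p.N.submoduleD(2)[OF p.N.submodule_rad_mult] by blast
  then have "module_length R ((simple_top R)\<lparr>carrier := rad_mult R (simple_top R)\<rparr>) = 0"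
    using p.N.length_zero_submodule by simp
  then show 0: "rad_length (simple_top R) = 0"
    by (simp add: rad_length_def zero_enat_def)
  show "top_length R (simple_top R) = 1"
    using p.N.length_eq_rad_add_top length_simple_top length_rad_mult[OF fin] 0
    by (simp add: one_enat_def)
qed

lemma betti_recurrence:
  defines "b \<equiv> \<lambda>n. betti R n (simple_top R)"
  shows "b 0 = 1" "e \<le> b 1" "e * b (Suc n) \<le> b (Suc (Suc n)) + a * b n"
proof -
  \<comment> \<open>\<open>?S n\<close> is the syzygy of index n + 1, so its top length is
    \<open>b (Suc n)\<close>. The simple module has elements of another type and cannot start the
    same sequence.\<close>
  let ?S = "\<lambda>n. (Omega R ^^ n) (Omega R (simple_top R))"
  note S0 = simple_top_bounds
  have fin: "fin_length_module R (?S n)" for n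
    by (induction n) (simp_all add: Omega_bounds(1) S0(1))
  show "b 0 = 1" using S0(3) by (simp add: b_def betti_def)
  show "e \<le> b 1" using Omega_bounds(3)[OF S0(1)] S0 by (simp add: b_def betti_def)
  \<comment> \<open>The radical of a syzygy is bounded through the top of its predecessor; that of
    \<open>?S 0\<close> is the simple module, hence the case split.\<close>
  have rad: "rad_length (?S n) \<le> a * b n" for n
  proof (cases n)
    case 0
    then show ?thesis using Omega_bounds(2)[OF S0(1)] by (simp add: b_def betti_def)
  next
    case (Suc m)
    then show ?thesis using Omega_bounds(2)[OF fin[of m]] by (simp add: b_def betti_def)
  qed
  show "e * b (Suc n) \<le> b (Suc (Suc n)) + a * b n"
    using Omega_bounds(3)[OF fin[of n]] rad[of n] by (simp add: b_def betti_def)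
qed

end


section \<open>The growth rate\<close>

text \<open>The recurrence says that D_n = t (n+1) - s t n satisfies D_(n+1) \<ge> r D_n, and the
  initial values give D_0 \<ge> r. As s and t n are nonnegative, D_n is a lower bound for t
  (n+1).\<close>

lemma power_le_of_recurrence:
  fixes t :: "nat \<Rightarrow> real" and r s :: real
  assumes "r \<ge> 0" "s \<ge> 0" "t 0 = 1" "r + s \<le> t 1"
    and rec: "\<And>n. (r + s) * t (Suc n) \<le> t (Suc (Suc n)) + r * s * t n"
  shows "r ^ n \<le> t n"
proof -
  have diff: "r ^ Suc n \<le> t (Suc n) - s * t n" for n
  proof (induction n)
    case 0
    then show ?case using assms by simp
  next
    case (Suc n)
    have "r ^ Suc (Suc n) \<le> r * (t (Suc n) - s * t n)"
      using mult_left_mono[OF Suc.IH \<open>r \<ge> 0\<close>] by simp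
    also have "\<dots> \<le> t (Suc (Suc n)) - s * t (Suc n)"
      using rec[of n] by (simp add: algebra_simps)
    finally show ?case .
  qed
  show ?thesis
  proof (induction n)
    case (Suc n)
    have "0 \<le> t n" using Suc zero_le_power[OF \<open>r \<ge> 0\<close>, of n] by linarith
    then have "0 \<le> s * t n" using \<open>s \<ge> 0\<close> by simp
    then show ?case using diff[of n] by linarith
  qed (use assms in simp)
qed

theorem (in short_local_ring) growth_ge:
  assumes "real a \<le> 1 / 4 * (real e)\<^sup>2"
  shows "gamma_alg R \<ge> ereal (1 / 2 * (real e + sqrt ((real e)\<^sup>2 - 4 * real a)))"
proof -
  define d where "d = sqrt ((real e)\<^sup>2 - 4 * real a)"
  define r where "r = 1 / 2 * (real e + d)"
  define s where "s = 1 / 2 * (real e - d)"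
  define t where "t = (\<lambda>n. real (betti R n (simple_top R)))"
  have d2: "d\<^sup>2 = (real e)\<^sup>2 - 4 * real a" using assms by (simp add: d_def)
  have d0: "0 \<le> d" using assms by (simp add: d_def)
  \<comment> \<open>Since d^2 = e^2 - 4a with a \<ge> 0; this makes the smaller root
    nonnegative.\<close>
  have "d \<le> real e" by (rule power2_le_imp_le) (simp_all add: d2)
  then have rs: "r \<ge> 0" "s \<ge> 0" using d0 by (simp_all add: r_def s_def)
  have sum: "r + s = real e" by (simp add: r_def s_def field_simps)
  have prod: "r * s = real a"
    using d2 by (simp add: r_def s_def field_simps power2_eq_square)
  note b = betti_recurrence
  have rec: "(r + s) * t (Suc n) \<le> t (Suc (Suc n)) + r * s * t n" for n
    using b(3)[of n] unfolding t_def sum prod by (metis of_nat_add of_nat_le_iff of_nat_mult)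
  have "r ^ n \<le> t n" for n
    by (rule power_le_of_recurrence[where r = r and s = s])
      (use rs rec b(1,2) in \<open>simp_all add: t_def sum\<close>)
  then have "r \<le> root n (t n)" if "n > 0" for n
    using that rs(1) real_root_le_mono[of n "r ^ n" "t n"] by (simp add: real_root_power_cancel)
  \<comment> \<open>The bound starts at 1 because \<open>root 0\<close> is constantly 0.\<close>
  then have "\<forall>\<^sub>F n in sequentially. ereal r \<le> ereal (root n (t n))"
    unfolding eventually_sequentially by (intro exI[of _ 1]) auto
  then have "ereal r \<le> limsup (\<lambda>n. ereal (root n (t n)))"
    by (intro le_Limsup) auto
  then show ?thesis
    by (simp add: gamma_alg_def growth_def r_def d_def t_def)
qed

text \<open>Since K maps onto A/J, every element is the sum of an element of J and a scalar multiple
  of 1, and the latter is central. Two-sidedness of J and left invertibility outside J both follow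
  from this decomposition.\<close>

lemma short_local_algebra_imp_short_local_ring:
  assumes "short_local_algebra K A" "hilbert_type A e a"
  shows "short_local_ring A e a"
proof -
  have kalg: "k_algebra K A" and loc: "is_local_ring A"
    and cube: "radical A \<cdot>\<^bsub>A\<^esub> radical A \<cdot>\<^bsub>A\<^esub> radical A = {\<zero>\<^bsub>A\<^esub>}"
    and iso: "(\<lambda>c. radical A +>\<^bsub>A\<^esub> (c \<odot>\<^bsub>A\<^esub> \<one>\<^bsub>A\<^esub>)) \<in> ring_iso K (A Quot radical A)"
    using assms(1) unfolding short_local_algebra_def by blast+
  interpret A: ring A using kalg by (simp add: k_algebra_def)
  interpret K: field K using kalg by (simp add: k_algebra_def)
  interpret alg: k_algebra K A by (rule kalg)
  interpret reg: plain_left_module A "regular_module A" by (rule A.plain_left_module_regular)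
  let ?J = "radical A"
  note D = reg.submoduleD[OF A.submodule_radical]
  have Jc: "x \<in> carrier A" if "x \<in> ?J" for x using D(1) that by auto
  have Jl: "x \<otimes>\<^bsub>A\<^esub> j \<in> ?J" if "x \<in> carrier A" "j \<in> ?J" for x j using D(5) that by simp
  have Ja: "x \<oplus>\<^bsub>A\<^esub> y \<in> ?J" if "x \<in> ?J" "y \<in> ?J" for x y using D(3) that by simp
  have Jm: "\<ominus>\<^bsub>A\<^esub> x \<in> ?J" if "x \<in> ?J" for x
    using Jl[of "\<ominus>\<^bsub>A\<^esub> \<one>\<^bsub>A\<^esub>" x] that Jc by (simp add: A.l_minus)
  have sg: "subgroup ?J (add_monoid A)"
    using Jc D(2) Ja Jm by (auto simp: subgroup_def a_inv_def[symmetric])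
  have c1: "c \<odot>\<^bsub>A\<^esub> \<one>\<^bsub>A\<^esub> \<in> carrier A" if "c \<in> carrier K" for c using that by (simp add: alg.smult_closed)
  have split: "\<exists>c\<in>carrier K. \<exists>j\<in>?J. r = j \<oplus>\<^bsub>A\<^esub> c \<odot>\<^bsub>A\<^esub> \<one>\<^bsub>A\<^esub>" if r: "r \<in> carrier A" for r
  proof -
    have "?J +>\<^bsub>A\<^esub> r \<in> carrier (A Quot ?J)"
      using r by (auto simp: FactRing_def A_RCOSETS_def')
    moreover have "carrier (A Quot ?J) = (\<lambda>c. ?J +>\<^bsub>A\<^esub> (c \<odot>\<^bsub>A\<^esub> \<one>\<^bsub>A\<^esub>)) ` carrier K"
      using iso unfolding ring_iso_def by (auto dest: bij_betw_imp_surj_on)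
    ultimately obtain c where c: "c \<in> carrier K" "?J +>\<^bsub>A\<^esub> r = ?J +>\<^bsub>A\<^esub> (c \<odot>\<^bsub>A\<^esub> \<one>\<^bsub>A\<^esub>)" by auto
    have "\<zero>\<^bsub>A\<^esub> \<oplus>\<^bsub>A\<^esub> r \<in> ?J +>\<^bsub>A\<^esub> r"
      using D(1,2) r by (intro A.a_rcosI) auto
    then have "r \<in> ?J +>\<^bsub>A\<^esub> (c \<odot>\<^bsub>A\<^esub> \<one>\<^bsub>A\<^esub>)" using r c(2) by simp
    then show ?thesis using c(1) unfolding a_r_coset_def' by blast
  qed
  have scal: "x \<otimes>\<^bsub>A\<^esub> (c \<odot>\<^bsub>A\<^esub> \<one>\<^bsub>A\<^esub>) = c \<odot>\<^bsub>A\<^esub> x" "(c \<odot>\<^bsub>A\<^esub> \<one>\<^bsub>A\<^esub>) \<otimes>\<^bsub>A\<^esub> x = c \<odot>\<^bsub>A\<^esub> x"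
    if "c \<in> carrier K" "x \<in> carrier A" for c x
    using that alg.smult_mult_left[of c "\<one>\<^bsub>A\<^esub>" x] alg.smult_mult_right[of c x "\<one>\<^bsub>A\<^esub>"] by simp_all
  have Js: "c \<odot>\<^bsub>A\<^esub> j \<in> ?J" if "c \<in> carrier K" "j \<in> ?J" for c j
    using Jl[OF c1 that(2)] that Jc by (simp add: scal)
  \<comment> \<open>Multiplying \<open>j\<close> by the decomposition of \<open>r\<close> gives a
    product inside J and a scalar multiple of \<open>j\<close>; J, being a left ideal, contains
    both.\<close>
  have Jr: "j \<otimes>\<^bsub>A\<^esub> r \<in> ?J" if j: "j \<in> ?J" and r: "r \<in> carrier A" for j r
  proof -
    obtain c i where c: "c \<in> carrier K" "i \<in> ?J" "r = i \<oplus>\<^bsub>A\<^esub> c \<odot>\<^bsub>A\<^esub> \<one>\<^bsub>A\<^esub>"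
      using split[OF r] by blast
    then have "j \<otimes>\<^bsub>A\<^esub> r = j \<otimes>\<^bsub>A\<^esub> i \<oplus>\<^bsub>A\<^esub> c \<odot>\<^bsub>A\<^esub> j"
      using j Jc c1 by (simp add: A.r_distr scal)
    then show ?thesis using Ja Jl Js Jc c j by simp
  qed
  have ideal: "ideal ?J A"
    by (rule idealI) (use A.ring_axioms sg Jl Jr in auto)
  have one: "\<one>\<^bsub>A\<^esub> \<notin> ?J"
  proof
    assume 1: "\<one>\<^bsub>A\<^esub> \<in> ?J"
    obtain I where I: "maximal_left_ideal A I" using loc by (auto simp: is_local_ring_def)
    then have sub: "submodule I A (regular_module A)" and ne: "I \<noteq> carrier A"
      by (auto simp: maximal_left_ideal_def)
    have "\<one>\<^bsub>A\<^esub> \<in> I" using 1 I by (auto simp: radical_def)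
    then have "x \<in> I" if "x \<in> carrier A" for x
      using reg.submoduleD(5)[OF sub, of x "\<one>\<^bsub>A\<^esub>"] that by simp
    with ne reg.submoduleD(1)[OF sub] show False by auto
  qed
  have inv: "\<exists>s\<in>carrier A. s \<otimes>\<^bsub>A\<^esub> r = \<one>\<^bsub>A\<^esub>" if r: "r \<in> carrier A" "r \<notin> ?J" for r
  proof -
    obtain c j where c: "c \<in> carrier K" "j \<in> ?J" "r = j \<oplus>\<^bsub>A\<^esub> c \<odot>\<^bsub>A\<^esub> \<one>\<^bsub>A\<^esub>"
      using split[OF r(1)] by blast
    have "c \<noteq> \<zero>\<^bsub>K\<^esub>" using c r(2) Jc by auto
    then have "c \<in> Units K" using c(1) K.field_Units by simp
    then have d: "inv\<^bsub>K\<^esub> c \<in> carrier K" "inv\<^bsub>K\<^esub> c \<otimes>\<^bsub>K\<^esub> c = \<one>\<^bsub>K\<^esub>" by auto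
    define y where "y = inv\<^bsub>K\<^esub> c \<odot>\<^bsub>A\<^esub> j"
    have yJ: "y \<in> ?J" using Js d c by (simp add: y_def)
    note y = Jc[OF yJ]
    have "inv\<^bsub>K\<^esub> c \<odot>\<^bsub>A\<^esub> (c \<odot>\<^bsub>A\<^esub> \<one>\<^bsub>A\<^esub>) = \<one>\<^bsub>A\<^esub>"
      using d c(1) by (simp flip: alg.smult_assoc1)
    then have u: "inv\<^bsub>K\<^esub> c \<odot>\<^bsub>A\<^esub> r = y \<oplus>\<^bsub>A\<^esub> \<one>\<^bsub>A\<^esub>"
      using d c Jc by (simp add: alg.smult_r_distr y_def)
    have y3: "y \<otimes>\<^bsub>A\<^esub> y \<otimes>\<^bsub>A\<^esub> y = \<zero>\<^bsub>A\<^esub>"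
      using ideal_prod.prod[OF ideal_prod.prod[OF yJ yJ] yJ] cube by auto
    \<comment> \<open>The geometric series for the inverse of 1 + y, which ends with y^2 because y^3
      = 0. The scalar inverse of \<open>c\<close> then turns it into a left inverse of
      \<open>r\<close>.\<close>
    define q where "q = \<one>\<^bsub>A\<^esub> \<oplus>\<^bsub>A\<^esub> (\<ominus>\<^bsub>A\<^esub> y \<oplus>\<^bsub>A\<^esub> y \<otimes>\<^bsub>A\<^esub> y)"
    have q: "q \<in> carrier A" using y by (simp add: q_def)
    have "q \<otimes>\<^bsub>A\<^esub> y = y \<oplus>\<^bsub>A\<^esub> \<ominus>\<^bsub>A\<^esub> (y \<otimes>\<^bsub>A\<^esub> y)"
      using y y3 by (simp add: q_def A.l_distr A.l_minus)
    then have "q \<otimes>\<^bsub>A\<^esub> (y \<oplus>\<^bsub>A\<^esub> \<one>\<^bsub>A\<^esub>) = (y \<oplus>\<^bsub>A\<^esub> \<ominus>\<^bsub>A\<^esub> (y \<otimes>\<^bsub>A\<^esub> y)) \<oplus>\<^bsub>A\<^esub> q"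
      using q y by (simp add: A.r_distr)
    also have "\<dots> = \<one>\<^bsub>A\<^esub>"
      using y by (simp add: q_def A.a_ac A.r_neg A.r_neg1 A.r_neg2)
    finally have "(q \<otimes>\<^bsub>A\<^esub> (inv\<^bsub>K\<^esub> c \<odot>\<^bsub>A\<^esub> \<one>\<^bsub>A\<^esub>)) \<otimes>\<^bsub>A\<^esub> r = \<one>\<^bsub>A\<^esub>"
      using q d r(1) u c1[OF d(1)] by (simp add: A.m_assoc scal(2))
    moreover have "q \<otimes>\<^bsub>A\<^esub> (inv\<^bsub>K\<^esub> c \<odot>\<^bsub>A\<^esub> \<one>\<^bsub>A\<^esub>) \<in> carrier A" using q c1[OF d(1)] by simp
    ultimately show ?thesis by blast
  qed
  show ?thesis
  proof (intro short_local_ring.intro short_local_ring_axioms.intro A.ring_axioms ideal one inv)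
    show "v \<otimes>\<^bsub>A\<^esub> j = \<zero>\<^bsub>A\<^esub>" if "v \<in> ?J \<cdot>\<^bsub>A\<^esub> ?J" "j \<in> ?J" for v j
      using ideal_prod.prod[OF that] cube by auto
  qed (use assms(2) in \<open>auto simp: hilbert_type_def Let_def\<close>)
qed

theorem theorem7:
  fixes K :: "'k ring" and A :: "('k, 'a) module" and e a :: nat
  assumes "field K"
    and "short_local_algebra K A"
    and "hilbert_type A e a"
    and "real a \<le> 1 / 4 * (real e)\<^sup>2"
  shows "gamma_alg A \<ge> ereal (1 / 2 * (real e + sqrt ((real e)\<^sup>2 - 4 * real a)))"
  by (rule short_local_ring.growth_ge[OF short_local_algebra_imp_short_local_ring[OF assms(2,3)] assms(4)])

end
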